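(* For every integer $n\geq 2$, the $B$-permutahedron $\overline{\Pi}_n$ has a facet-Hamiltonian cycle.
   Context: The $B$-permutahedron $\overline{\Pi}_n$ is the convex hull of $\{(\pm\pi(1),\ldots,\pm\pi(n)) : \pi\in S_n\}$ (all sign choices), an $n$-dimensional polytope. Its skeleton is the graph of its vertices and edges; its edges join signed permutations differing either in an adjacent transposition of entries (keeping signs) or in changing the sign of the first entry. A facet of a $d$-dimensional polytope is a face of dimension $d-1$. A facet-Hamiltonian cycle of a polytope $P$ is a cycle $C$ in the skeleton of $P$ such that for every facet $F$ of $P$, the intersection of $C$ with $F$ (the subgraph of $C$ induced by the vertices of $C$ lying in $F$) is nonempty and connected. *)

theory Defs
  imports "HOL-Analysis.Analysis"
begin

(* The coordinates are indexed by an arbitrary finite type 'n with CARD('n) = n, so a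
   permutation of {1..n} is a bijection from the index type onto {1..CARD('n)}. *)
definition B_permutahedron :: "(real ^ 'n) set" where
  "B_permutahedron = convex hull
     {(\<chi> i. s i * real (p i)) | (s :: 'n \<Rightarrow> real) (p :: 'n \<Rightarrow> nat).
        (\<forall>i. s i \<in> {-1, 1}) \<and> bij_betw p UNIV {1..CARD('n)}}"

definition skeleton_verts :: "'a::euclidean_space set \<Rightarrow> 'a set" where
  "skeleton_verts P = {v. v extreme_point_of P}"

definition skeleton_edges :: "'a::euclidean_space set \<Rightarrow> 'a set set" where
  "skeleton_edges P =
     {{u, v} | u v. u \<in> skeleton_verts P \<and> v \<in> skeleton_verts P \<and> closed_segment u v edge_of P}"

definition connected_graph :: "'a set \<Rightarrow> 'a set set \<Rightarrow> bool" where
  "connected_graph V E \<longleftrightarrow>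
     (\<forall>u\<in>V. \<forall>v\<in>V. (u, v) \<in> {(x, y). x \<in> V \<and> y \<in> V \<and> {x, y} \<in> E}\<^sup>*)"

(* A cycle is given by the list of its vertices in cyclic order, without repetition of the
   first vertex at the end. *)
definition cycle_edges :: "'a list \<Rightarrow> 'a set set" where
  "cycle_edges c = {{c ! i, c ! (Suc i mod length c)} | i. i < length c}"

definition is_cycle :: "'a set \<Rightarrow> 'a set set \<Rightarrow> 'a list \<Rightarrow> bool" where
  "is_cycle V E c \<longleftrightarrow>
     3 \<le> length c \<and> distinct c \<and> set c \<subseteq> V \<and> cycle_edges c \<subseteq> E"

definition facet_hamiltonian_cycle :: "'a::euclidean_space set \<Rightarrow> 'a list \<Rightarrow> bool" where
  "facet_hamiltonian_cycle P c \<longleftrightarrow>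
     is_cycle (skeleton_verts P) (skeleton_edges P) c \<and>
     (\<forall>F. F facet_of P \<longrightarrow>
        set c \<inter> F \<noteq> {} \<and>
        connected_graph (set c \<inter> F) {e \<in> cycle_edges c. e \<subseteq> F})"

end

theory Submission imports Defs begin

text \<open>Write a vertex as the word of its signed coordinates, in order of decreasing absolute value.
  Edges are then swaps of adjacent letters and flips of the sign of the last letter, and facets
  correspond to nonempty signed sets, a vertex lying on a facet iff the set is a prefix of its word.
  Each edge enters exactly one new facet, so a closed walk of length \<open>3^n - 1\<close> that meets all facets
  enters each of them exactly once.

  Such walks come from an induction over words with an unsigned marker \<open>*\<close>. Suppose that a walk from
  \<open>u *\<close> to \<open>v *\<close> has \<open>3^n - 1\<close> marker moves and \<open>3^n - n - 1\<close> other moves, and that the part before the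
  marker runs through all signed sets. Replace \<open>*\<close> by a new letter \<open>-x\<close> and let a new marker zigzag
  around it, ending at \<open>v * -x\<close>. Flip \<open>-x\<close>, move the marker to the end and \<open>+x\<close> to the front, and run
  through the old walk backwards behind \<open>+x\<close>. This leads from \<open>u -x *\<close> to \<open>+x u *\<close>. In the end the
  marker is deleted and the cycle is closed by moving \<open>+x\<close> through \<open>u\<close> and flipping it.\<close>

subsection \<open>Walks of words with a marker\<close>

definition swap_adj :: "'a list \<Rightarrow> 'a list \<Rightarrow> bool" where
  "swap_adj xs ys \<longleftrightarrow> (\<exists>r a b s. xs = r @ [a, b] @ s \<and> ys = r @ [b, a] @ s)"

definition flip_last :: "('a \<times> bool) list \<Rightarrow> ('a \<times> bool) list \<Rightarrow> bool" where
  "flip_last xs ys \<longleftrightarrow> (\<exists>r i \<sigma>. xs = r @ [(i, \<sigma>)] \<and> ys = r @ [(i, \<not> \<sigma>)])"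

definition word_adj :: "('a \<times> bool) list \<Rightarrow> ('a \<times> bool) list \<Rightarrow> bool" where
  "word_adj xs ys \<longleftrightarrow> swap_adj xs ys \<or> flip_last xs ys"

definition signed_perm :: "'a set \<Rightarrow> ('a \<times> bool) list \<Rightarrow> bool" where
  "signed_perm X w \<longleftrightarrow> distinct (map fst w) \<and> fst ` set w = X"

text \<open>The empty set counts, so that there are \<open>3 ^ card X\<close> of these sets and the
  induction can start at \<open>X = {}\<close>.\<close>

definition signed_sets :: "'a set \<Rightarrow> ('a \<times> bool) set set" where
  "signed_sets X = {c. fst ` c \<subseteq> X \<and> inj_on fst c}"

lemma swap_adj_append: "swap_adj xs ys \<Longrightarrow> swap_adj (zs @ xs @ ws) (zs @ ys @ ws)"
  unfolding swap_adj_def by (metis append_assoc)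

lemma swap_adj_Cons: "swap_adj xs ys \<Longrightarrow> swap_adj (x # xs) (x # ys)"
  using swap_adj_append[of xs ys "[x]" "[]"] by simp

lemma swap_adj_sym: "swap_adj xs ys \<Longrightarrow> swap_adj ys xs"
  unfolding swap_adj_def by blast

lemma swap_adj_set: "swap_adj xs ys \<Longrightarrow> set ys = set xs"
  unfolding swap_adj_def by auto

lemma flip_last_append: "flip_last xs ys \<Longrightarrow> flip_last (zs @ xs) (zs @ ys)"
  unfolding flip_last_def by (metis append_assoc)

lemma flip_last_sym: "flip_last xs ys \<Longrightarrow> flip_last ys xs"
  unfolding flip_last_def by force

lemma word_adj_append: "word_adj xs ys \<Longrightarrow> word_adj (zs @ xs) (zs @ ys)"
  unfolding word_adj_def using swap_adj_append[of xs ys zs "[]"] flip_last_append by auto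

lemma word_adj_Cons: "word_adj xs ys \<Longrightarrow> word_adj (x # xs) (x # ys)"
  using word_adj_append[of xs ys "[x]"] by simp

lemma word_adj_sym: "word_adj xs ys \<Longrightarrow> word_adj ys xs"
  unfolding word_adj_def using swap_adj_sym flip_last_sym by blast

lemma word_adj_length: "word_adj xs ys \<Longrightarrow> length ys = length xs"
  unfolding word_adj_def swap_adj_def flip_last_def by auto

lemma word_adj_signed_perm: "word_adj xs ys \<Longrightarrow> signed_perm X xs \<Longrightarrow> signed_perm X ys"
  unfolding word_adj_def swap_adj_def flip_last_def signed_perm_def by (auto; force)

section \<open>Words with a marker and their walks\<close>

text \<open>A pair \<open>(p, q)\<close> stands for the word \<open>p @ q\<close> with an extra unsigned marker between \<open>p\<close> and
  \<open>q\<close>; because of it, the last letter of \<open>p\<close> cannot be flipped when \<open>q = []\<close>.\<close>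

definition marker_move ::
  "('a \<times> bool) list \<times> ('a \<times> bool) list \<Rightarrow> ('a \<times> bool) list \<times> ('a \<times> bool) list \<Rightarrow> bool" where
  "marker_move a b \<longleftrightarrow>
     (\<exists>p x q. a = (p, x # q) \<and> b = (p @ [x], q) \<or> a = (p @ [x], q) \<and> b = (p, x # q))"

definition word_move ::
  "('a \<times> bool) list \<times> ('a \<times> bool) list \<Rightarrow> ('a \<times> bool) list \<times> ('a \<times> bool) list \<Rightarrow> bool" where
  "word_move a b \<longleftrightarrow>
     swap_adj (fst a) (fst b) \<and> snd a = snd b \<or> fst a = fst b \<and> word_adj (snd a) (snd b)"

text \<open>\<open>walk a V s m b\<close>: some walk from \<open>a\<close> to \<open>b\<close> has vertex set \<open>V\<close>, \<open>s\<close> marker moves and \<open>m\<close> word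
  moves (a state may be repeated). The two counts drive the counting argument at the end.\<close>

inductive walk where
  refl: "walk a {a} 0 0 a"
| marker: "marker_move a b \<Longrightarrow> walk b V s m c \<Longrightarrow> walk a (insert a V) (Suc s) m c"
| word: "word_move a b \<Longrightarrow> walk b V s m c \<Longrightarrow> walk a (insert a V) s (Suc m) c"

lemma marker_move_up: "marker_move (p, x # q) (p @ [x], q)"
  and marker_move_down: "marker_move (p @ [x], q) (p, x # q)"
  unfolding marker_move_def by metis+

lemma marker_move_sym: "marker_move a b \<Longrightarrow> marker_move b a"
  unfolding marker_move_def by blast

lemma word_move_sym: "word_move a b \<Longrightarrow> word_move b a"
  unfolding word_move_def using swap_adj_sym word_adj_sym by metis

lemma marker_move_Cons:
  "marker_move (p, q) (p', q') \<Longrightarrow> marker_move (x # p, q) (x # p', q')"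
  unfolding marker_move_def by (metis Pair_inject append_Cons)

lemma word_move_Cons:
  "word_move (p, q) (p', q') \<Longrightarrow> word_move (x # p, q) (x # p', q')"
  unfolding word_move_def using swap_adj_Cons by auto

lemma walk_ends: "walk a V s m b \<Longrightarrow> a \<in> V \<and> b \<in> V"
  by (induction rule: walk.induct) auto

lemma walk_trans:
  "walk a V s m b \<Longrightarrow> walk b V' s' m' c \<Longrightarrow> walk a (V \<union> V') (s + s') (m + m') c"
proof (induction rule: walk.induct)
  case (refl a)
  then show ?case using walk_ends[OF refl] by (simp add: insert_absorb)
qed (auto intro: walk.intros)

lemma walk_marker1: "marker_move a b \<Longrightarrow> walk a {a, b} 1 0 b"
  using walk.marker[OF _ walk.refl] by fastforce

lemma walk_word1: "word_move a b \<Longrightarrow> walk a {a, b} 0 1 b"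
  using walk.word[OF _ walk.refl] by fastforce

lemma walk_rev: "walk a V s m b \<Longrightarrow> walk b V s m a"
proof (induction rule: walk.induct)
  case (marker a b V s m c)
  from walk_trans[OF marker.IH walk_marker1[OF marker_move_sym[OF marker.hyps(1)]]]
  show ?case using walk_ends[OF marker.hyps(2)] by (simp add: insert_absorb)
next
  case (word a b V s m c)
  from walk_trans[OF word.IH walk_word1[OF word_move_sym[OF word.hyps(1)]]]
  show ?case using walk_ends[OF word.hyps(2)] by (simp add: insert_absorb)
qed (rule walk.refl)

lemma walk_Cons:
  "walk a V s m b \<Longrightarrow> walk (x # fst a, snd a) ((\<lambda>v. (x # fst v, snd v)) ` V) s m (x # fst b, snd b)"
proof (induction rule: walk.induct)
  case (refl a)
  show ?case using walk.refl by simp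
next
  case (marker a b V s m c)
  show ?case using walk.marker[OF marker_move_Cons marker.IH, of "fst a" "snd a"] marker.hyps(1)
    by simp
next
  case (word a b V s m c)
  show ?case using walk.word[OF word_move_Cons word.IH, of "fst a" "snd a"] word.hyps(1)
    by simp
qed

text \<open>Deleting the marker makes marker moves trivial and turns word moves into edges, so only
  the \<open>m\<close> word moves lengthen the list.\<close>

lemma walk_trail:
  assumes "walk a V s m b"
  shows "\<exists>xs. length xs = Suc m \<and> hd xs = fst a @ snd a \<and> last xs = fst b @ snd b \<and>
    successively word_adj xs \<and> set xs = (\<lambda>v. fst v @ snd v) ` V"
  using assms
proof (induction rule: walk.induct)
  case (refl a)
  show ?case by (rule exI[of _ "[fst a @ snd a]"]) simp
next
  case (marker a b V s m c)
  then obtain xs where xs: "length xs = Suc m" "hd xs = fst b @ snd b" "last xs = fst c @ snd c"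
    "successively word_adj xs" "set xs = (\<lambda>v. fst v @ snd v) ` V" by blast
  have "fst a @ snd a = fst b @ snd b"
    using marker.hyps(1) unfolding marker_move_def by auto
  then show ?case using xs walk_ends[OF marker.hyps(2)] by (intro exI[of _ xs]) auto
next
  case (word a b V s m c)
  then obtain xs where xs: "length xs = Suc m" "hd xs = fst b @ snd b" "last xs = fst c @ snd c"
    "successively word_adj xs" "set xs = (\<lambda>v. fst v @ snd v) ` V" by blast
  have "word_adj (fst a @ snd a) (fst b @ snd b)"
    using word.hyps(1) word_adj_append swap_adj_append[of "fst a" "fst b" "[]"]
    unfolding word_move_def word_adj_def by fastforce
  then show ?case using xs
    by (intro exI[of _ "(fst a @ snd a) # xs"]) (cases xs, auto)
qed

section \<open>A new marker zigzagging around the old one\<close>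

text \<open>The letter \<open>x\<close> takes the place of the marker and a new marker is put next to it. The side on
  which the new marker sits while the old one is at rest depends on the parity of the old position:
  the new marker crosses \<open>x\<close> once per stop of the old marker, and a move of the old marker changes
  the parity.\<close>

definition enter :: "'a \<times> bool \<Rightarrow> ('a \<times> bool) list \<times> ('a \<times> bool) list \<Rightarrow> _" where
  "enter x a = (if even (length (snd a)) then (fst a @ [x], snd a) else (fst a, x # snd a))"

definition leave :: "'a \<times> bool \<Rightarrow> ('a \<times> bool) list \<times> ('a \<times> bool) list \<Rightarrow> _" where
  "leave x a = (if even (length (snd a)) then (fst a, x # snd a) else (fst a @ [x], snd a))"

lemma enter_leave: "marker_move (enter x a) (leave x a)"
  unfolding enter_def leave_def by (simp add: marker_move_up marker_move_down)

lemma swap_adj_pair: "swap_adj (r @ a # b # s) (r @ b # a # s)"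
  unfolding swap_adj_def by auto

lemma swap_adj_pair': "swap_adj (a # b # s) (b # a # s)"
  using swap_adj_pair[of "[]"] by simp

text \<open>When the old marker passes \<open>y\<close>, both \<open>x\<close> and the new marker
  have to pass \<open>y\<close>. As the resting side changes with the parity, one swap and one
  marker move suffice. The swap takes place while \<open>x\<close> and \<open>y\<close> are on the
  same side of the new marker, which fixes the order of the two moves.\<close>

lemma leave_enter_marker:
  assumes "marker_move a b"
  shows "\<exists>V. walk (leave x a) V 1 1 (enter x b)"
proof -
  have mw: "\<exists>V. walk c V 1 1 e" if "marker_move c d" "word_move d e" for c d e :: "('a \<times> bool) list \<times> ('a \<times> bool) list"
    using walk_trans[OF walk_marker1[OF that(1)] walk_word1[OF that(2)]] by auto
  have wm: "\<exists>V. walk c V 1 1 e" if "word_move c d" "marker_move d e" for c d e :: "('a \<times> bool) list \<times> ('a \<times> bool) list"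
    using walk_trans[OF walk_word1[OF that(1)] walk_marker1[OF that(2)]] by auto
  from assms obtain p y q where
    "a = (p, y # q) \<and> b = (p @ [y], q) \<or> a = (p @ [y], q) \<and> b = (p, y # q)"
    unfolding marker_move_def by blast
  then show ?thesis
  proof (elim disjE conjE)
    assume ab: "a = (p, y # q)" "b = (p @ [y], q)"
    show ?thesis
    proof (cases "even (length q)")
      case True
      then show ?thesis unfolding ab enter_def leave_def
        by (intro mw[where d = "(p @ [x, y], q)"])
          (auto simp: marker_move_up marker_move_down marker_move_up[of "_ @ [_]", simplified]
            marker_move_down[of "_ @ [_]", simplified] word_move_def swap_adj_pair)
    next
      case False
      then show ?thesis unfolding ab enter_def leave_def
        by (intro wm[where d = "(p, y # x # q)"])
          (auto simp: marker_move_up marker_move_down marker_move_up[of "_ @ [_]", simplified]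
            marker_move_down[of "_ @ [_]", simplified] word_move_def word_adj_def swap_adj_pair')
    qed
  next
    assume ab: "a = (p @ [y], q)" "b = (p, y # q)"
    show ?thesis
    proof (cases "even (length q)")
      case True
      then show ?thesis unfolding ab enter_def leave_def
        by (intro mw[where d = "(p, y # x # q)"])
          (auto simp: marker_move_up marker_move_down marker_move_up[of "_ @ [_]", simplified]
            marker_move_down[of "_ @ [_]", simplified] word_move_def word_adj_def swap_adj_pair')
    next
      case False
      then show ?thesis unfolding ab enter_def leave_def
        by (intro wm[where d = "(p @ [x, y], q)"])
          (auto simp: marker_move_up marker_move_down marker_move_up[of "_ @ [_]", simplified]
            marker_move_down[of "_ @ [_]", simplified] word_move_def swap_adj_pair)
    qed
  qed
qed

text \<open>A word move keeps the length of the suffix, hence the side of the new marker. The letter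
  \<open>x\<close> is put at the end of the prefix or at the front of the suffix, where it separates
  no neighbours and leaves a flippable last letter in place.\<close>

lemma enter_word_move:
  assumes "word_move a b"
  shows "word_move (enter x a) (enter x b)"
  using assms swap_adj_append[of "fst a" "fst b" "[]" "[x]"] word_adj_Cons[of "snd a" "snd b" x]
    word_adj_length[of "snd a" "snd b"]
  unfolding word_move_def enter_def by auto

text \<open>The \<open>s + 1\<close> rests of the old marker give one crossing of \<open>x\<close>
  each, and each of its \<open>s\<close> moves gives one further marker move and one swap. A
  crossing exhibits the prefix both with and without \<open>x\<close>.\<close>

lemma walk_zigzag:
  assumes "walk a V s m b"
  shows "\<exists>W. walk (enter x a) W (2 * s + 1) (s + m) (leave x b) \<and>
    (\<forall>v\<in>V. (\<exists>w\<in>W. set (fst w) = set (fst v)) \<and> (\<exists>w\<in>W. set (fst w) = insert x (set (fst v))))"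
  using assms
proof (induction rule: walk.induct)
  case (refl a)
  show ?case
    by (rule exI[of _ "{enter x a, leave x a}"])
      (use walk_marker1[OF enter_leave[of x a]] in \<open>auto simp: enter_def leave_def\<close>)
next
  case (marker a b V s m c)
  then obtain W where W: "walk (enter x b) W (2 * s + 1) (s + m) (leave x c)"
    "\<forall>v\<in>V. (\<exists>w\<in>W. set (fst w) = set (fst v)) \<and> (\<exists>w\<in>W. set (fst w) = insert x (set (fst v)))"
    by blast
  obtain U where U: "walk (leave x a) U 1 1 (enter x b)"
    using leave_enter_marker[OF marker.hyps(1)] by blast
  have "walk (enter x a) ({enter x a, leave x a} \<union> U \<union> W) (1 + 1 + (2 * s + 1)) (0 + 1 + (s + m))
    (leave x c)"
    using walk_trans[OF walk_trans[OF walk_marker1[OF enter_leave] U] W(1)] .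
  then show ?case using W(2)
    by (intro exI[of _ "{enter x a, leave x a} \<union> U \<union> W"])
      (auto simp: enter_def leave_def)
next
  case (word a b V s m c)
  then obtain W where W: "walk (enter x b) W (2 * s + 1) (s + m) (leave x c)"
    "\<forall>v\<in>V. (\<exists>w\<in>W. set (fst w) = set (fst v)) \<and> (\<exists>w\<in>W. set (fst w) = insert x (set (fst v)))"
    by blast
  \<comment> \<open>No crossing is made at \<open>a\<close>, but a word move only reorders the
    prefix, so the states found for \<open>b\<close> serve for \<open>a\<close> too.\<close>
  have "set (fst a) = set (fst b)"
    using word.hyps(1) swap_adj_set unfolding word_move_def by metis
  then show ?case using W walk.word[OF enter_word_move[OF word.hyps(1)] W(1)] walk_ends[OF word.hyps(2)]
    by (intro exI[of _ "insert (enter x a) W"]) auto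
qed

section \<open>Induction step: adding a new index\<close>

lemma walk_descend:
  "\<exists>V. walk (v @ [x], q) V 0 (length v) (x # v, q)"
proof (induction v rule: rev_induct)
  case Nil
  show ?case using walk.refl by fastforce
next
  case (snoc y v)
  have "word_move ((v @ [y]) @ [x], q) (v @ [x] @ [y], q)"
    using swap_adj_pair[of v y x] unfolding word_move_def by auto
  moreover have "\<exists>V. walk (v @ [x] @ [y], q) V 0 (length v) (x # v @ [y], q)"
  proof -
    \<comment> \<open>Appending \<open>y\<close> to the prefix is compatible with word moves but not
      with marker moves, since \<open>y\<close> would stand between the letters and the marker;
      hence the condition \<open>s = 0\<close>.\<close>
    have app: "\<exists>V'. walk (fst a @ [y], snd a) V' 0 m (fst b @ [y], snd b)" if "walk a V s m b" "s = 0"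
      for a b V s m
      using that
    proof (induction rule: walk.induct)
      case (refl a)
      show ?case using walk.refl by fast
    next
      case (word a b V s m c)
      have *: "word_move (fst a @ [y], snd a) (fst b @ [y], snd b)"
        using word.hyps(1) swap_adj_append[of "fst a" "fst b" "[]" "[y]"]
        unfolding word_move_def by auto
      then show ?case using word.IH word.prems walk.word[OF *] by blast
    qed simp
    from snoc obtain V where "walk (v @ [x], q) V 0 (length v) (x # v, q)" by blast
    from app[OF this] show ?thesis by simp
  qed
  ultimately show ?case using walk.word by fastforce
qed

lemma signed_set_cases:
  assumes "c \<in> signed_sets (insert i X)"
  obtains "c \<in> signed_sets X" | \<sigma> d where "c = insert (i, \<sigma>) d" "d \<in> signed_sets X"
proof (cases "i \<in> fst ` c")
  case False
  then show ?thesis using assms that(1) unfolding signed_sets_def by auto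
next
  case True
  then obtain \<sigma> where s: "(i, \<sigma>) \<in> c" by auto
  have "fst y \<noteq> i" if "y \<in> c - {(i, \<sigma>)}" for y
    using assms s that unfolding signed_sets_def inj_on_def by fastforce
  then have "c - {(i, \<sigma>)} \<in> signed_sets X"
    using assms inj_on_subset[of fst c "c - {(i, \<sigma>)}"] unfolding signed_sets_def by auto
  with that(2)[of \<sigma> "c - {(i, \<sigma>)}"] s show ?thesis by auto
qed

text \<open>The counts add up as follows: the zigzag has \<open>2 * s + 1\<close> marker and
  \<open>s + m\<close> word moves, the flip is one word move, passing \<open>(i, True)\<close> is
  one marker move, carrying it to the front takes \<open>length v\<close> swaps, and the reversed
  walk has \<open>s\<close> and \<open>m\<close> moves again.\<close>

lemma walk_extend:
  assumes W: "walk (u, []) V s m (v, [])" and cov: "signed_sets X \<subseteq> (\<lambda>a. set (fst a)) ` V"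
  shows "\<exists>W. walk (u @ [(i, False)], []) W (3 * s + 2) (2 * m + s + 1 + length v) ((i, True) # u, []) \<and>
    signed_sets (insert i X) \<subseteq> (\<lambda>a. set (fst a)) ` W"
proof -
  obtain W1 where W1: "walk (u @ [(i, False)], []) W1 (2 * s + 1) (s + m) (v, [(i, False)])"
    "\<forall>v\<in>V. (\<exists>w\<in>W1. set (fst w) = set (fst v)) \<and>
      (\<exists>w\<in>W1. set (fst w) = insert (i, False) (set (fst v)))"
    using walk_zigzag[OF W, of "(i, False)"] by (auto simp: enter_def leave_def)
  have "word_move (v, [(i, False)]) (v, [(i, True)])"
    by (auto simp: word_move_def word_adj_def flip_last_def)
  note W2 = walk_word1[OF this]
  have "marker_move (v, [(i, True)]) (v @ [(i, True)], [])"
    by (auto simp: marker_move_up)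
  note W3 = walk_marker1[OF this]
  obtain W4 where W4: "walk (v @ [(i, True)], []) W4 0 (length v) ((i, True) # v, [])"
    using walk_descend by blast
  define W6 where "W6 = (\<lambda>v. ((i, True) # fst v, snd v)) ` V"
  have W5: "walk ((i, True) # v, []) W6 s m ((i, True) # u, [])"
    using walk_Cons[OF walk_rev[OF W], of "(i, True)"] unfolding W6_def by simp
  let ?W = "W1 \<union> {(v, [(i, False)]), (v, [(i, True)])} \<union>
     {(v, [(i, True)]), (v @ [(i, True)], [])} \<union> W4 \<union> W6"
  have "walk (u @ [(i, False)], []) ?W (2 * s + 1 + 0 + 1 + 0 + s) (s + m + 1 + 0 + length v + m)
     ((i, True) # u, [])"
    by (rule walk_trans[OF walk_trans[OF walk_trans[OF walk_trans[OF W1(1) W2] W3] W4] W5])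
  moreover have "2 * s + 1 + 0 + 1 + 0 + s = 3 * s + 2"
    "s + m + 1 + 0 + length v + m = 2 * m + s + 1 + length v" by simp_all
  \<comment> \<open>Sets without \<open>i\<close> and sets with \<open>(i, False)\<close> are met in
    the zigzag, sets with \<open>(i, True)\<close> in the reversed walk.\<close>
  moreover have "signed_sets (insert i X) \<subseteq> (\<lambda>a. set (fst a)) ` ?W"
  proof
    fix c assume "c \<in> signed_sets (insert i X)"
    then show "c \<in> (\<lambda>a. set (fst a)) ` ?W"
    proof (cases rule: signed_set_cases)
      case 1
      then obtain a where a: "a \<in> V" "c = set (fst a)" using cov by blast
      then obtain w where "w \<in> W1" "set (fst w) = c" using W1(2) by metis
      then show ?thesis by blast
    next
      case (2 \<sigma> d)
      then obtain a where a: "a \<in> V" "d = set (fst a)" using cov by blast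
      show ?thesis
      proof (cases \<sigma>)
        case True
        have "((i, True) # fst a, snd a) \<in> W6" using a unfolding W6_def by auto
        then show ?thesis using 2 a True by (intro image_eqI[of _ _ "((i, True) # fst a, snd a)"]) auto
      next
        case False
        then obtain w where "w \<in> W1" "set (fst w) = insert (i, False) (set (fst a))"
          using W1(2) a by auto
        then show ?thesis using 2 a False by (intro image_eqI[of _ _ w]) auto
      qed
    qed
  qed
  ultimately show ?thesis by metis
qed

text \<open>With \<open>n = card X\<close>, the values \<open>s = 3 ^ n - 1\<close> and
  \<open>m = 3 ^ n - n - 1\<close> are what the recurrences \<open>3 * s + 2\<close> and
  \<open>2 * m + s + 1 + n\<close> produce, starting from a walk with a single state.\<close>

lemma walk_exists:
  assumes "finite X"
  shows "\<exists>u v V s m. walk (u, []) V s m (v, []) \<and> signed_sets X \<subseteq> (\<lambda>a. set (fst a)) ` V \<and>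
    signed_perm X u \<and> signed_perm X v \<and> s + 1 = 3 ^ card X \<and> m + card X + 1 = 3 ^ card X"
  using assms
proof (induction X rule: finite_induct)
  case empty
  have "signed_sets ({} :: 'a set) = {{}}" unfolding signed_sets_def by auto
  then show ?case
    by (intro exI[of _ "[]"] exI[of _ "{([],[])}"] exI[of _ 0]) (simp add: walk.refl signed_perm_def)
next
  case (insert i X)
  then obtain u v V s m where *: "walk (u, []) V s m (v, [])" "signed_sets X \<subseteq> (\<lambda>a. set (fst a)) ` V"
    "signed_perm X u" "signed_perm X v" "s + 1 = 3 ^ card X" "m + card X + 1 = 3 ^ card X"
    by blast
  obtain W where W: "walk (u @ [(i, False)], []) W (3 * s + 2) (2 * m + s + 1 + length v) ((i, True) # u, [])"
    "signed_sets (insert i X) \<subseteq> (\<lambda>a. set (fst a)) ` W"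
    using walk_extend[OF *(1,2)] by blast
  have "length v = card X"
    using *(4) distinct_card[of "map fst v"] unfolding signed_perm_def by simp
  then have "3 * s + 2 + 1 = 3 ^ card (insert i X)"
    "2 * m + s + 1 + length v + card (insert i X) + 1 = 3 ^ card (insert i X)"
    using insert.hyps *(5,6) by auto
  moreover have "signed_perm (insert i X) (u @ [(i, False)])" "signed_perm (insert i X) ((i, True) # u)"
    using *(3) insert.hyps unfolding signed_perm_def by auto
  ultimately show ?case using W by blast
qed

text \<open>The last extension is carried out separately because it shows that the two ends contain
  the same \<open>u\<close>, on which closing the cycle relies. With the marker deleted,
  \<open>3 ^ n - n\<close> words remain for \<open>n = card X\<close>.\<close>

lemma trail_exists:
  assumes "finite X" "X \<noteq> {}"
  shows "\<exists>u i xs. signed_perm (X - {i}) u \<and> i \<in> X \<and>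
    length xs + card X = 3 ^ card X \<and> hd xs = u @ [(i, False)] \<and> last xs = (i, True) # u \<and>
    successively word_adj xs \<and>
    (\<forall>c\<in>signed_sets X. \<exists>w\<in>set xs. \<exists>k. c = set (take k w))"
proof -
  obtain i where i: "i \<in> X" using assms by blast
  define Y where "Y = X - {i}"
  have X: "X = insert i Y" "i \<notin> Y" "finite Y" using i assms unfolding Y_def by auto
  obtain u v V s m where *: "walk (u, []) V s m (v, [])" "signed_sets Y \<subseteq> (\<lambda>a. set (fst a)) ` V"
    "signed_perm Y u" "signed_perm Y v" "s + 1 = 3 ^ card Y" "m + card Y + 1 = 3 ^ card Y"
    using walk_exists[OF X(3)] by blast
  obtain W where W: "walk (u @ [(i, False)], []) W (3 * s + 2) (2 * m + s + 1 + length v) ((i, True) # u, [])"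
    "signed_sets X \<subseteq> (\<lambda>a. set (fst a)) ` W"
    using walk_extend[OF *(1,2)] X by blast
  have "length v = card Y"
    using *(4) distinct_card[of "map fst v"] unfolding signed_perm_def by simp
  then have m: "Suc (2 * m + s + 1 + length v) + card X = 3 ^ card X"
    using *(5,6) X by auto
  obtain xs where xs: "length xs = Suc (2 * m + s + 1 + length v)" "hd xs = u @ [(i, False)]"
    "last xs = (i, True) # u" "successively word_adj xs" "set xs = (\<lambda>v. fst v @ snd v) ` W"
    using walk_trail[OF W(1)] by auto
  have "\<exists>w\<in>set xs. \<exists>k. c = set (take k w)" if c: "c \<in> signed_sets X" for c
  proof -
    have "c \<in> (\<lambda>a. set (fst a)) ` W" using W(2) c by (rule subsetD)
    then obtain a where a: "a \<in> W" "c = set (fst a)" by (elim imageE)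
    then have "c = set (take (length (fst a)) (fst a @ snd a))" by simp
    then show ?thesis using xs(5) a(1) by blast
  qed
  moreover have "length xs + card X = 3 ^ card X" using xs(1) m by simp
  moreover have "signed_perm (X - {i}) u" using *(3) unfolding Y_def .
  ultimately show ?thesis using xs(2-4) i by blast
qed

subsection \<open>From the walk to a cycle of words\<close>

text \<open>The chain of signed sets whose facets contain the vertex of \<open>w\<close>; it starts
  at length 1 because the empty set stands for no facet.\<close>

definition prefix_sets :: "'a list \<Rightarrow> 'a set set" where
  "prefix_sets w = (\<lambda>k. set (take k w)) ` {1..length w}"

lemma finite_prefix_sets: "finite (prefix_sets w)"
  unfolding prefix_sets_def by simp

lemma card_prefix_sets_le: "card (prefix_sets w) \<le> length w"
  unfolding prefix_sets_def using card_image_le[of "{1..length w}"] by fastforce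

lemma prefix_sets_I: "c = set (take k w) \<Longrightarrow> c \<noteq> {} \<Longrightarrow> c \<in> prefix_sets w"
  \<comment> \<open>\<open>k\<close> may exceed the length of \<open>w\<close>, hence the
    minimum.\<close>
  unfolding prefix_sets_def
  by (rule image_eqI[of _ _ "min k (length w)"]) (cases "k = 0", auto simp: min_def Suc_le_eq)

lemma prefix_sets_card_length:
  "c \<in> prefix_sets w \<Longrightarrow> card c = length w \<Longrightarrow> distinct w \<Longrightarrow> c = set w"
  unfolding prefix_sets_def by (auto simp: distinct_card)

lemma prefix_sets_singleton:
  assumes "{x} \<in> prefix_sets w" "distinct w"
  shows "x = hd w"
proof -
  obtain k where k: "{x} = set (take k w)" "1 \<le> k" "k \<le> length w"
    using assms(1) unfolding prefix_sets_def by auto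
  have "card (set (take k w)) = k" using k(3) assms(2) distinct_card[of "take k w"] by simp
  then have "k = 1" unfolding k(1)[symmetric] by simp
  then show ?thesis using k by (cases w) auto
qed

lemma prefix_sets_diff:
  assumes "length ys = length xs" "\<And>k. set (take k ys) = c \<or> set (take k ys) = set (take k xs)"
  shows "prefix_sets ys - prefix_sets xs \<subseteq> {c}"
proof
  fix d assume d: "d \<in> prefix_sets ys - prefix_sets xs"
  then obtain k where k: "k \<in> {1..length xs}" "d = set (take k ys)"
    unfolding prefix_sets_def using assms(1) by auto
  then have "d \<noteq> set (take k xs)" using d unfolding prefix_sets_def by blast
  then show "d \<in> {c}" using assms(2)[of k] k(2) by auto
qed

text \<open>A swap changes only the prefix that ends between the two letters, a flip only the full
  word; so an edge enters at most one facet.\<close>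

lemma prefix_sets_adj:
  assumes "word_adj xs ys"
  shows "\<exists>c. prefix_sets ys - prefix_sets xs \<subseteq> {c}"
  using assms unfolding word_adj_def
proof
  assume "swap_adj xs ys"
  then obtain r a b s where xy: "xs = r @ [a, b] @ s" "ys = r @ [b, a] @ s"
    unfolding swap_adj_def by blast
  have "set (take k ys) = set (r @ [b]) \<or> set (take k ys) = set (take k xs)" for k
  proof -
    consider "k \<le> length r" | "k = Suc (length r)" | j where "k = length r + Suc (Suc j)"
      by (metis add_Suc_right less_eq_Suc_le less_iff_Suc_add linorder_not_le
          nat_less_le not_less_eq_eq add_Suc)
    then show ?thesis by cases (auto simp: xy)
  qed
  then have "prefix_sets ys - prefix_sets xs \<subseteq> {set (r @ [b])}"
    by (intro prefix_sets_diff) (use xy in simp_all)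
  then show ?thesis by blast
next
  assume "flip_last xs ys"
  then obtain r i \<sigma> where xy: "xs = r @ [(i, \<sigma>)]" "ys = r @ [(i, \<not> \<sigma>)]"
    unfolding flip_last_def by blast
  have "set (take k ys) = set ys \<or> set (take k ys) = set (take k xs)" for k
    by (cases "k \<le> length r") (auto simp: xy)
  then have "prefix_sets ys - prefix_sets xs \<subseteq> {set ys}"
    by (intro prefix_sets_diff) (use xy in simp_all)
  then show ?thesis by blast
qed

text \<open>Describes the words in which \<open>x\<close> moves through \<open>u\<close>: as
  \<open>j\<close> grows, prefixes of \<open>u\<close> are gained and prefixes containing
  \<open>x\<close> are lost, each in order of length.\<close>

lemma prefix_sets_insert:
  assumes "j \<le> length u"
  shows "prefix_sets (take j u @ x # drop j u) =
    (\<lambda>k. set (take k u)) ` {1..j} \<union> (\<lambda>k. insert x (set (take k u))) ` {j..length u}"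
    (is "?L = ?R")
proof -
  have lo: "set (take k (take j u @ x # drop j u)) = set (take k u)" if "k \<le> j" for k
    using that assms by (simp add: min_def)
  have hi: "set (take (Suc k) (take j u @ x # drop j u)) = insert x (set (take k u))" if "j \<le> k" for k
  proof -
    have "take k u = take j u @ take (k - j) (drop j u)"
      using that by (metis le_add_diff_inverse take_add)
    then have "set (take k u) = set (take j u) \<union> set (take (k - j) (drop j u))" by simp
    then show ?thesis using that assms by (simp add: min_def Suc_diff_le)
  qed
  have "{1..Suc (length u)} = {1..j} \<union> Suc ` {j..length u}"
    using assms by (auto simp: image_Suc_atLeastAtMost)
  then have "?L = (\<lambda>k. set (take k (take j u @ x # drop j u))) ` {1..j} \<union>
     (\<lambda>k. set (take (Suc k) (take j u @ x # drop j u))) ` {j..length u}"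
  proof -
    have "length (take j u @ x # drop j u) = Suc (length u)" using assms by simp
    then show ?thesis
      unfolding prefix_sets_def \<open>{1..Suc (length u)} = _\<close>[symmetric]
      using \<open>{1..Suc (length u)} = _\<close> by (simp only: image_Un image_image)
  qed
  also have "\<dots> = ?R" using lo hi by (intro arg_cong2[of _ _ _ _ "(\<union>)"] image_cong) auto
  finally show ?thesis .
qed

section \<open>Counting new elements along a sequence of sets\<close>

text \<open>If each step adds at most one element and the total leaves no slack, then the element added in
  a step has never occurred before. Hence every element occurs in a single block of indices.\<close>

lemma new_element_each_step:
  fixes f :: "nat \<Rightarrow> 'b set"
  assumes fin: "\<And>j. j \<le> M \<Longrightarrow> finite (f j)" and n: "card (f 0) \<le> n"
    and step: "\<And>j. j < M \<Longrightarrow> \<exists>c. f (Suc j) - f j \<subseteq> {c}"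
    and total: "n + M \<le> card (\<Union>j\<le>M. f j)" and j: "j < M"
  shows "\<exists>c. f (Suc j) - f j = {c} \<and> c \<notin> (\<Union>i\<le>j. f i)"
proof -
  define U where "U = (\<lambda>j. \<Union>i\<le>j. f i)"
  have finU: "finite (U j)" if "j \<le> M" for j using that fin unfolding U_def by auto
  have Suc: "U (Suc j) = U j \<union> (f (Suc j) - f j)" for j
    unfolding U_def by (auto simp: atMost_Suc)
  have step_le: "card (U (Suc j)) \<le> Suc (card (U j))" if j: "j < M" for j
  proof -
    obtain c where "f (Suc j) - f j \<subseteq> {c}" using step[OF j] by blast
    then have "U (Suc j) \<subseteq> insert c (U j)" unfolding Suc by blast
    then have "card (U (Suc j)) \<le> card (insert c (U j))" using finU j by (intro card_mono) auto
    also have "\<dots> \<le> Suc (card (U j))" by (rule card_insert_le_m1[of "Suc (card (U j))", simplified]) simp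
    finally show ?thesis .
  qed
  have upper: "card (U j) \<le> n + j" if "j \<le> M" for j
    using that
  proof (induction j)
    case 0
    then show ?case using n unfolding U_def by simp
  next
    case (Suc j)
    then show ?case using step_le[of j] by simp
  qed
  \<comment> \<open>The total is traced backwards: each of the remaining \<open>M - j\<close> steps
    adds at most one element.\<close>
  have lower: "n + M \<le> card (U j) + (M - j)" if "j \<le> M" for j
    using that
  proof (induction rule: inc_induct)
    case base
    then show ?case using total unfolding U_def by simp
  next
    case (step k)
    then show ?case using step_le[of k] by simp
  qed
  \<comment> \<open>The upper bound \<open>n + j\<close> at \<open>j\<close> lies below the lower
    bound \<open>n + Suc j\<close> at \<open>Suc j\<close>.\<close>
  have "card (U j) < card (U (Suc j))"
    using upper[of j] lower[of "Suc j"] j by simp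
  then have "U (Suc j) \<noteq> U j" by auto
  then have "\<not> f (Suc j) \<subseteq> U j" unfolding Suc by blast
  then obtain d where d: "d \<in> f (Suc j)" "d \<notin> U j" by blast
  then have "d \<in> f (Suc j) - f j" unfolding U_def by auto
  with step[OF j] have "f (Suc j) - f j = {d}" by blast
  with d(2) show ?thesis unfolding U_def by blast
qed

text \<open>On a return after an absence, \<open>c\<close> would be the element added there,
  although it has already occurred at \<open>i\<close>.\<close>

lemma new_element_convex:
  assumes new: "\<And>j. j < M \<Longrightarrow> \<exists>c. f (Suc j) - f j = {c} \<and> c \<notin> (\<Union>i\<le>j. f i)"
    and "i \<le> j" "c \<in> f i" "j \<le> k" "k \<le> M" "c \<in> f k"
  shows "c \<in> f j"
  using \<open>j \<le> k\<close> \<open>k \<le> M\<close> \<open>c \<in> f k\<close>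
proof (induction rule: dec_induct)
  case (step k)
  have "c \<in> f k"
  proof (rule ccontr)
    assume "c \<notin> f k"
    obtain d where d: "f (Suc k) - f k = {d}" "d \<notin> (\<Union>i\<le>k. f i)"
      using new[of k] step.prems(1) by auto
    moreover have "c \<in> f (Suc k) - f k" using \<open>c \<notin> f k\<close> step.prems(2) by blast
    ultimately have "c \<notin> (\<Union>i\<le>k. f i)" by simp
    then show False using \<open>i \<le> j\<close> \<open>c \<in> f i\<close> step.hyps by auto
  qed
  then show ?case using step by simp
qed

text \<open>The element added in the step to \<open>j\<close> lies in \<open>f j\<close> and in no
  earlier set.\<close>

lemma new_element_distinct:
  assumes new: "\<And>j. j < M \<Longrightarrow> \<exists>c. f (Suc j) - f j = {c} \<and> c \<notin> (\<Union>i\<le>j. f i)"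
    and "i < j" "j \<le> M"
  shows "f i \<noteq> f j"
proof -
  obtain k where k: "j = Suc k" using assms(2) by (cases j) auto
  then obtain c where "f j - f k = {c}" "c \<notin> (\<Union>i\<le>k. f i)" using new[of k] assms(3) by auto
  then have "c \<in> f j" "c \<notin> (\<Union>i\<le>k. f i)" by auto
  then show ?thesis using assms(2) k by auto
qed

text \<open>A signed set is a partial function from \<open>X\<close> to signs;
  \<open>bool option\<close> offers absence and the two signs.\<close>

lemma card_signed_sets:
  assumes "finite X"
  shows "finite (signed_sets X)" "3 ^ card X \<le> card (signed_sets X)"
proof -
  have "signed_sets X \<subseteq> Pow (X \<times> UNIV)" unfolding signed_sets_def by auto
  then show fin: "finite (signed_sets X)" using assms by (meson finite_Pow_iff finite_SigmaI finite_subset finite)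
  let ?F = "PiE X (\<lambda>_. UNIV :: bool option set)"
  let ?g = "\<lambda>f. {(i, b). i \<in> X \<and> f i = Some b}"
  have "inj_on ?g ?F"
  proof (rule inj_onI)
    fix f f' assume f: "f \<in> ?F" "f' \<in> ?F" "?g f = ?g f'"
    have "f i = f' i" if "i \<in> X" for i
    proof -
      have "f i = Some b \<longleftrightarrow> f' i = Some b" for b using f(3) that by blast
      then show ?thesis by (metis option.exhaust)
    qed
    then show "f = f'" using f by (auto intro: PiE_ext)
  qed
  moreover have "?g ` ?F \<subseteq> signed_sets X"
    unfolding signed_sets_def by (auto simp: inj_on_def)
  ultimately have "card ?F \<le> card (signed_sets X)"
    using fin by (rule card_inj_on_le)
  moreover have "card ?F = 3 ^ card X"
    using assms by (simp add: card_PiE card_UNIV_option)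
  ultimately show "3 ^ card X \<le> card (signed_sets X)" by simp
qed

section \<open>Arcs of a cyclic sequence and the closed cycle of words\<close>

definition cyclic_run :: "nat \<Rightarrow> (nat \<Rightarrow> bool) \<Rightarrow> (nat \<times> nat) set" where
  "cyclic_run L P = {(i, j). i < L \<and> j < L \<and> P i \<and> P j \<and> (j = Suc i mod L \<or> i = Suc j mod L)}"

lemma cyclic_run_sym: "(i, j) \<in> (cyclic_run L P)\<^sup>* \<Longrightarrow> (j, i) \<in> (cyclic_run L P)\<^sup>*"
  by (rule symD[OF sym_rtrancl]) (auto simp: sym_def cyclic_run_def)

lemma cyclic_run_segment:
  assumes "i \<le> j" "j < L" "\<And>k. i \<le> k \<Longrightarrow> k \<le> j \<Longrightarrow> P k"
  shows "(i, j) \<in> (cyclic_run L P)\<^sup>*"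
  using assms
proof (induction rule: dec_induct)
  case (step k)
  then have "(k, Suc k) \<in> cyclic_run L P" unfolding cyclic_run_def by auto
  then show ?case using step by (meson Suc_lessD le_Suc_eq rtrancl.rtrancl_into_rtrancl)
qed simp

text \<open>The trail \<open>xs\<close> meets every nonempty signed set in a single block of
  indices. The words added to close the cycle contain no further signed sets and only prolong blocks
  that touch an end of \<open>xs\<close>, so each block becomes an arc of the cycle.\<close>

lemma cycle_exists:
  assumes X: "finite X" "2 \<le> card X"
  obtains ys where "3 \<le> length ys" "distinct ys" "\<And>w. w \<in> set ys \<Longrightarrow> signed_perm X w"
    "\<And>i. i < length ys \<Longrightarrow> word_adj (ys ! i) (ys ! (Suc i mod length ys))"
    "\<And>c. c \<in> signed_sets X \<Longrightarrow> c \<noteq> {} \<Longrightarrow> \<exists>w\<in>set ys. c \<in> prefix_sets w"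
    "\<And>c i j. i < length ys \<Longrightarrow> j < length ys \<Longrightarrow> c \<in> prefix_sets (ys ! i) \<Longrightarrow> c \<in> prefix_sets (ys ! j) \<Longrightarrow>
      (i, j) \<in> (cyclic_run (length ys) (\<lambda>k. c \<in> prefix_sets (ys ! k)))\<^sup>*"
proof -
  define n where "n = card X"
  have "X \<noteq> {}" using X by auto
  then obtain u i0 xs where u: "signed_perm (X - {i0}) u" "i0 \<in> X" and
    xs: "length xs + n = 3 ^ n" "hd xs = u @ [(i0, False)]" "last xs = (i0, True) # u"
    "successively word_adj xs" and cov: "\<forall>c\<in>signed_sets X. \<exists>w\<in>set xs. \<exists>k. c = set (take k w)"
    using trail_exists[OF X(1)] unfolding n_def by blast
  define m where "m = length u"
  have "card (X - {i0}) = length u"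
    using u(1) distinct_card[of "map fst u"] unfolding signed_perm_def by simp
  then have n: "n = Suc m" using u(2) X unfolding n_def m_def by simp
  have m1: "1 \<le> m" using n X(2) unfolding n_def by simp
  let ?x = "(i0, True)"
  have du: "distinct u" and xu: "?x \<notin> set u" and xu': "(i0, False) \<notin> set u"
    using u(1) image_eqI[of i0 fst "(i0, _)" "set u"] unfolding signed_perm_def distinct_map
    by auto
  have "{} \<in> signed_sets X" unfolding signed_sets_def by simp
  then have xs_ne: "xs \<noteq> []" using cov by auto
  define N where "N = length xs"
  have N0: "0 < N" using xs_ne unfolding N_def by simp
  \<comment> \<open>\<open>xs\<close> ends at \<open>A 0\<close>, and \<open>A m\<close> is one flip away from the head of \<open>xs\<close>.\<close>
  define A where "A = (\<lambda>j. take j u @ ?x # drop j u)"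
  define ys where "ys = xs @ map A [1..<Suc m]"
  define L where "L = length ys"
  have L: "L = N + m" unfolding L_def ys_def N_def by simp
  have ys_xs: "ys ! i = xs ! i" if "i < N" for i
    using that unfolding ys_def N_def by (simp add: nth_append)
  have ys_A: "ys ! (N - 1 + j) = A j" if "j \<le> m" for j
  proof (cases j)
    case 0
    then show ?thesis using ys_xs[of "N - 1"] N0 xs(3) xs_ne unfolding A_def N_def
      by (simp add: last_conv_nth)
  next
    case (Suc k)
    then have "N - 1 + j = N + k" using N0 by simp
    moreover have "ys ! (N + k) = A (Suc k)"
      using that Suc unfolding ys_def N_def by (simp add: nth_append del: upt_Suc)
    ultimately show ?thesis using Suc by simp
  qed
  have ys_0: "ys ! 0 = u @ [(i0, False)]"
    using ys_xs[OF N0] xs(2) xs_ne by (simp add: hd_conv_nth)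
  have signed: "signed_perm X (u @ [(i0, False)])"
    using u unfolding signed_perm_def by auto
  have adj_xs: "word_adj (xs ! i) (xs ! Suc i)" if "Suc i < N" for i
    using xs(4) that unfolding N_def by (simp add: successively_conv_nth)
  have adj: "word_adj (ys ! i) (ys ! Suc i)" if "Suc i < L" for i
  proof (cases "Suc i < N")
    case True
    then show ?thesis using ys_xs[of i] ys_xs[of "Suc i"] adj_xs by simp
  next
    case False
    define j where "j = i - (N - 1)"
    have j: "i = N - 1 + j" "j < m" using False that N0 unfolding j_def L by auto
    have "A j = take j u @ [?x, u ! j] @ drop (Suc j) u"
      "A (Suc j) = take j u @ [u ! j, ?x] @ drop (Suc j) u"
      using j(2) unfolding A_def m_def by (simp_all add: Cons_nth_drop_Suc take_Suc_conv_app_nth)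
    then have "word_adj (A j) (A (Suc j))" unfolding word_adj_def swap_adj_def by blast
    moreover have "ys ! i = A j" "ys ! Suc i = A (Suc j)"
      using ys_A[of j] ys_A[of "Suc j"] j by simp_all
    ultimately show ?thesis by simp
  qed
  have adj_wrap: "word_adj (ys ! (L - 1)) (ys ! 0)"
  proof -
    have "ys ! (L - 1) = A m" using ys_A[of m] N0 unfolding L by simp
    then show ?thesis unfolding ys_0 A_def m_def word_adj_def flip_last_def by auto
  qed
  have perm: "signed_perm X (ys ! i)" if "i < L" for i
    using that
  proof (induction i)
    case 0
    then show ?case using ys_0 signed by simp
  next
    case (Suc i)
    then show ?case using word_adj_signed_perm[OF adj] by simp
  qed
  have perm_dl: "distinct (ys ! i)" "length (ys ! i) = n" if "i < L" for i
    using perm[OF that] distinct_card[of "map fst (ys ! i)"] unfolding signed_perm_def n_def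
    by (auto simp: distinct_map)
  define g where "g = (\<lambda>i. prefix_sets (ys ! i))"
  have covered: "\<exists>i<N. c \<in> g i" if c: "c \<in> signed_sets X" "c \<noteq> {}" for c
  proof -
    obtain w k where w: "w \<in> set xs" "c = set (take k w)" using cov c by blast
    then obtain i where "i < N" "w = xs ! i" unfolding N_def by (metis in_set_conv_nth)
    then show ?thesis using prefix_sets_I[OF w(2) c(2)] ys_xs unfolding g_def by auto
  qed
  have new: "\<exists>c. g (Suc j) - g j = {c} \<and> c \<notin> (\<Union>i\<le>j. g i)" if "j < N - 1" for j
  proof (rule new_element_each_step[where n = n and M = "N - 1"])
    show "finite (g j)" for j unfolding g_def by (rule finite_prefix_sets)
    show "card (g 0) \<le> n" using card_prefix_sets_le[of "ys ! 0"] perm_dl(2)[of 0] L N0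
      unfolding g_def by simp
    show "\<exists>c. g (Suc j) - g j \<subseteq> {c}" if "j < N - 1" for j
      unfolding g_def using that L by (intro prefix_sets_adj adj) auto
    \<comment> \<open>The budget is exact: \<open>n\<close> sets at the first word and at most one
      for each of the \<open>N - 1\<close> steps make \<open>3 ^ n - 1\<close>, the number of
      nonempty signed sets.\<close>
    have "3 ^ n - 1 \<le> card (signed_sets X - {{}})"
      using card_signed_sets[OF X(1)] \<open>{} \<in> signed_sets X\<close>
      unfolding n_def by (simp add: card_Diff_singleton_if diff_le_mono)
    also have "\<dots> \<le> card (\<Union>j\<le>N - 1. g j)"
    proof (rule card_mono)
      show "finite (\<Union>j\<le>N - 1. g j)" unfolding g_def by (auto simp: finite_prefix_sets)
      show "signed_sets X - {{}} \<subseteq> (\<Union>j\<le>N - 1. g j)"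
        using covered N0 by (fastforce simp: less_Suc_eq_le)
    qed
    finally have "3 ^ n - 1 \<le> card (\<Union>j\<le>N - 1. g j)" .
    moreover have "n + (N - 1) = 3 ^ n - 1" using xs(1) N0 unfolding N_def by linarith
    ultimately show "n + (N - 1) \<le> card (\<Union>j\<le>N - 1. g j)" by simp
    show "j < N - 1" by fact
  qed
  have convex: "c \<in> g j" if "i \<le> j" "c \<in> g i" "j \<le> k" "k < N" "c \<in> g k" for c i j k
    using new_element_convex[of "N - 1" g i j c k] new that by auto
  have gA: "g (N - 1 + j) = (\<lambda>k. set (take k u)) ` {1..j} \<union> (\<lambda>k. insert ?x (set (take k u))) ` {j..m}"
    if "j \<le> m" for j
    unfolding g_def ys_A[OF that] A_def m_def using that by (intro prefix_sets_insert) (simp add: m_def)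
  have g0: "set (take k u) \<in> g 0" if "1 \<le> k" "k \<le> m" for k
    unfolding g_def ys_0 prefix_sets_def using that by (intro image_eqI[of _ _ k]) (auto simp: m_def)
  have take_inj: "k = l" if "set (take k u) = set (take l u)" "k \<le> m" "l \<le> m" for k l
  proof -
    have "card (set (take k u)) = k" "card (set (take l u)) = l"
      using that(2,3) distinct_card[OF distinct_take[OF du]] unfolding m_def by simp_all
    then show ?thesis using arg_cong[OF that(1), of card] by linarith
  qed
  have take_x: "?x \<notin> set (take k u)" for k using xu by (meson in_set_takeD)
  \<comment> \<open>Among the closing words, the prefix of \<open>u\<close> of length
    \<open>k\<close> is present only from \<open>A k\<close> on, and the same prefix with
    \<open>?x\<close> added only up to \<open>A k\<close>.\<close>
  have low: "k \<le> j" if kj: "set (take k u) \<in> g (N - 1 + j)" "j \<le> m" "k \<le> m" for k j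
  proof -
    have "set (take k u) \<noteq> insert ?x (set (take l u))" for l using take_x by blast
    then obtain l where l: "l \<in> {1..j}" "set (take k u) = set (take l u)"
      using kj(1) unfolding gA[OF kj(2)] by blast
    then show ?thesis using take_inj[OF l(2) kj(3)] kj(2) by simp
  qed
  have high: "j \<le> k" if kj: "insert ?x (set (take k u)) \<in> g (N - 1 + j)" "j \<le> m" "k \<le> m" for k j
  proof -
    have "insert ?x (set (take k u)) \<noteq> set (take l u)" for l using take_x by blast
    then obtain l where l: "l \<in> {j..m}" "insert ?x (set (take k u)) = insert ?x (set (take l u))"
      using kj(1) unfolding gA[OF kj(2)] by blast
    then have "set (take k u) = set (take l u)" using insert_ident[OF take_x take_x] by blast
    then show ?thesis using take_inj[OF _ kj(3)] l(1) by auto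
  qed
  \<comment> \<open>If \<open>A j\<close> were the word at \<open>i < N\<close>, the block of
    \<open>{hd u}\<close> would contain all indices from 0 to \<open>i\<close>, and that of the full
    letter set of \<open>A j\<close> all from \<open>i\<close> to \<open>N - 1\<close>. But some
    word of \<open>xs\<close> starts with \<open>(i0, False)\<close>, and it has neither set as a
    prefix set.\<close>
  have A_new: "A j \<noteq> ys ! i" if j: "1 \<le> j" "j \<le> m" and i: "i < N" for i j
  proof
    assume "A j = ys ! i"
    then have gi: "g i = g (N - 1 + j)" using ys_A[OF j(2)] unfolding g_def by simp
    have "{(i0, False)} \<in> signed_sets X" using u(2) unfolding signed_sets_def by auto
    then obtain t where t: "t < N" "{(i0, False)} \<in> g t" using covered by blast
    have 1: "set (take 1 u) \<in> g i" unfolding gi gA[OF j(2)] using j by auto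
    have 2: "insert ?x (set (take m u)) \<in> g i" unfolding gi gA[OF j(2)] using j by auto
    have 3: "insert ?x (set (take m u)) \<in> g (N - 1)" using gA[of 0] by auto
    have tL: "t < L" using t L by simp
    show False
    proof (cases "t \<le> i")
      case True
      then have "set (take 1 u) \<in> g t" using convex[of 0 t _ i] g0[of 1] m1 1 i by simp
      moreover have "set (take 1 u) = {hd u}" using m1 unfolding m_def by (cases u) auto
      ultimately have "hd u = (i0, False)"
        using t(2) prefix_sets_singleton perm_dl(1)[OF tL] unfolding g_def by metis
      then show False using xu' m1 unfolding m_def by (cases u) auto
    next
      case False
      then have *: "insert ?x (set u) \<in> g t" using convex[of i t _ "N - 1"] 2 3 t(1) unfolding m_def by simp
      have "card (insert ?x (set u)) = n" using xu du n by (simp add: distinct_card m_def)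
      then have "insert ?x (set u) = set (ys ! t)"
        using * perm_dl[OF tL] prefix_sets_card_length unfolding g_def by metis
      moreover have "(i0, False) \<in> set (ys ! t)"
        using t(2) unfolding g_def prefix_sets_def by (auto dest!: in_set_takeD equalityD1)
      ultimately show False using xu' by auto
    qed
  qed
  have A_inj: "A j \<noteq> A k" if "j < k" "k \<le> m" for j k
  proof -
    have "A j ! j = ?x" using that unfolding A_def m_def by (simp add: nth_append min_def)
    moreover have "A k ! j = u ! j" using that unfolding A_def m_def by (simp add: nth_append)
    ultimately show ?thesis using xu that unfolding m_def by (metis nth_mem order_less_le_trans)
  qed
  have "distinct ys"
  proof -
    have "distinct xs"
      unfolding distinct_conv_nth
    proof (intro allI impI)
      have lt: "xs ! i \<noteq> xs ! j" if "i < j" "j < N" for i j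
        using new_element_distinct[of "N - 1" g i j] new that ys_xs[of i] ys_xs[of j] unfolding g_def by fastforce
      show "xs ! i \<noteq> xs ! j" if "i < length xs" "j < length xs" "i \<noteq> j" for i j
        using lt[of i j] lt[of j i] that unfolding N_def by (metis linorder_neqE_nat)
    qed
    moreover have "inj_on A {1..<Suc m}"
      by (rule linorder_inj_onI) (use A_inj in auto)
    moreover have "set xs \<inter> A ` {1..<Suc m} = {}"
      using A_new ys_xs unfolding N_def by (fastforce simp: in_set_conv_nth)
    ultimately show ?thesis unfolding ys_def by (simp add: distinct_map del: upt_Suc)
  qed
  have run: "(i, j) \<in> (cyclic_run L (\<lambda>k. c \<in> g k))\<^sup>*"
    if "i < L" "j < L" "c \<in> g i" "c \<in> g j" for i j c
  proof -
    let ?R = "(cyclic_run L (\<lambda>k. c \<in> g k))\<^sup>*"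
    \<comment> \<open>By symmetry it suffices to connect all indices of the arc to one index
      \<open>h\<close>.\<close>
    have hub: ?thesis if "\<And>k. k < L \<Longrightarrow> c \<in> g k \<Longrightarrow> (k, h) \<in> ?R" for h
      using that[OF \<open>i < L\<close> \<open>c \<in> g i\<close>] cyclic_run_sym[OF that[OF \<open>j < L\<close> \<open>c \<in> g j\<close>]] by (rule rtrancl_trans)
    have tail: "\<exists>j. k = N - 1 + j \<and> 1 \<le> j \<and> j \<le> m" if "k < L" "\<not> k < N" for k
      using that L N0 by (intro exI[of _ "k - (N - 1)"]) auto
    \<comment> \<open>Prefixes of \<open>u\<close> have a block starting at 0, prolonged backwards
      across the wrap; prefixes with \<open>?x\<close> have a block ending at \<open>N - 1\<close>,
      prolonged forwards; all other sets occur in \<open>xs\<close> only.\<close>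
    consider (1) l where "c = set (take l u)" "1 \<le> l" "l \<le> m"
      | (2) l where "c = insert ?x (set (take l u))" "l \<le> m"
      | (3) "\<And>l. l \<le> m \<Longrightarrow> c \<noteq> insert ?x (set (take l u))"
         "\<And>l. 1 \<le> l \<Longrightarrow> l \<le> m \<Longrightarrow> c \<noteq> set (take l u)" by metis
    then show ?thesis
    proof cases
      case 1
      have c0: "c \<in> g 0" using g0[OF 1(2,3)] 1(1) by blast
      have "(k, 0) \<in> ?R" if k: "k < L" "c \<in> g k" for k
      proof (cases "k < N")
        case True
        have "(0, k) \<in> ?R"
          using convex[OF _ c0 _ True k(2)] k(1) by (intro cyclic_run_segment) blast+
        then show ?thesis by (rule cyclic_run_sym)
      next
        case False
        then obtain j where j: "k = N - 1 + j" "j \<le> m" using tail k by blast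
        have lj: "l \<le> j" using low[of l j] 1 k j by simp
        have mem: "c \<in> g q" if "k \<le> q" "q \<le> L - 1" for q
        proof -
          define j' where "j' = q - (N - 1)"
          have j': "q = N - 1 + j'" "j \<le> j'" "j' \<le> m"
            using that j N0 L unfolding j'_def by auto
          show ?thesis unfolding j'(1) gA[OF j'(3)] using lj j'(2) 1 by auto
        qed
        have "(k, L - 1) \<in> ?R"
        proof (rule cyclic_run_segment)
          show "k \<le> L - 1" "L - 1 < L" using k(1) by linarith+
        qed (rule mem)
        moreover have "(L - 1, 0) \<in> cyclic_run L (\<lambda>k. c \<in> g k)"
          using mem[of "L - 1"] k(1) c0 unfolding cyclic_run_def by auto
        ultimately show ?thesis by (rule rtrancl_into_rtrancl)
      qed
      then show ?thesis by (rule hub)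
    next
      case 2
      have "(k, N - 1) \<in> ?R" if k: "k < L" "c \<in> g k" for k
      proof (cases "k < N")
        case True
        have cN: "c \<in> g (N - 1)" using gA[of 0] 2 by auto
        show ?thesis
        proof (rule cyclic_run_segment)
          show "k \<le> N - 1" "N - 1 < L" using True N0 L by linarith+
          show "c \<in> g q" if "k \<le> q" "q \<le> N - 1" for q
            using convex[OF that(1) k(2) that(2) _ cN] N0 by simp
        qed
      next
        case False
        then obtain j where j: "k = N - 1 + j" "j \<le> m" using tail k by blast
        have lj: "j \<le> l" using high[of l j] 2 k j by simp
        have mem: "c \<in> g q" if "N - 1 \<le> q" "q \<le> k" for q
        proof -
          define j' where "j' = q - (N - 1)"
          have j': "q = N - 1 + j'" "j' \<le> j" "j' \<le> m"
            using that j unfolding j'_def by auto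
          show ?thesis unfolding j'(1) gA[OF j'(3)] using lj j'(2) 2 by auto
        qed
        have "(N - 1, k) \<in> ?R"
        proof (rule cyclic_run_segment)
          show "N - 1 \<le> k" "k < L" using j(1) k(1) by linarith+
        qed (rule mem)
        then show ?thesis by (rule cyclic_run_sym)
      qed
      then show ?thesis by (rule hub)
    next
      case 3
      have N: "k < N" if "k < L" "c \<in> g k" for k
        using tail[OF that(1)] that(2) 3 gA by fastforce
      have seg: "(p, q) \<in> ?R" if "p \<le> q" "q < L" "c \<in> g p" "c \<in> g q" for p q
        using convex[OF _ that(3) _ N[OF that(2,4)] that(4)] that(1,2)
        by (intro cyclic_run_segment) blast+
      show ?thesis
        using seg[of i j] cyclic_run_sym[OF seg[of j i]] that by (cases "i \<le> j") simp_all
    qed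
  qed
  show thesis
  proof (rule that[of ys])
    \<comment> \<open>The cycle has \<open>3 ^ n - 1\<close> words, hence at least 8.\<close>
    have "(3::nat) ^ 2 \<le> 3 ^ n" using X(2) unfolding n_def by (intro power_increasing) auto
    then show "3 \<le> length ys" using L xs(1) n unfolding L_def N_def by simp
    show "distinct ys" by fact
    show "signed_perm X w" if "w \<in> set ys" for w using that perm unfolding L_def by (metis in_set_conv_nth)
    show "word_adj (ys ! i) (ys ! (Suc i mod length ys))" if "i < length ys" for i
    proof (cases "Suc i = L")
      case True
      then have "i = L - 1" "Suc i mod length ys = 0" unfolding L_def by simp_all
      then show ?thesis using adj_wrap by metis
    next
      case False
      then show ?thesis using adj[of i] that unfolding L_def by simp
    qed
    show "\<exists>w\<in>set ys. c \<in> prefix_sets w" if "c \<in> signed_sets X" "c \<noteq> {}" for c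
      using covered[OF that] L unfolding g_def L_def by (metis nth_mem trans_less_add1)
    show "(i, j) \<in> (cyclic_run (length ys) (\<lambda>k. c \<in> prefix_sets (ys ! k)))\<^sup>*"
      if "i < length ys" "j < length ys" "c \<in> prefix_sets (ys ! i)" "c \<in> prefix_sets (ys ! j)" for c i j
      using run[of i j c] that unfolding g_def L_def by simp
  qed
qed

subsection \<open>Faces of the \<open>B\<close>-permutahedron\<close>

text \<open>A face of the hull is the hull of some points of \<open>S\<close>; as these lie in the
  face, they attain the value \<open>b\<close>.\<close>

lemma convex_hull_Int_supporting_hyperplane:
  fixes S :: "'a::euclidean_space set"
  assumes "compact S" "\<And>v. v \<in> S \<Longrightarrow> a \<bullet> v \<le> b"
  shows "convex hull S \<inter> {x. a \<bullet> x = b} = convex hull {v \<in> S. a \<bullet> v = b}"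
    and "convex hull {v \<in> S. a \<bullet> v = b} face_of convex hull S"
proof -
  let ?T = "convex hull S \<inter> {x. a \<bullet> x = b}"
  have "convex hull S \<subseteq> {x. a \<bullet> x \<le> b}"
    using assms(2) by (intro hull_minimal) (auto simp: convex_halfspace_le)
  then have face: "?T face_of convex hull S"
    by (intro face_of_Int_supporting_hyperplane_le) auto
  obtain S' where S': "S' \<subseteq> S" "?T = convex hull S'"
    using face_of_convex_hull_subset[OF assms(1) face] by blast
  have "S' \<subseteq> {v \<in> S. a \<bullet> v = b}"
    using S' hull_subset[of S' convex] by auto
  then have "?T \<subseteq> convex hull {v \<in> S. a \<bullet> v = b}"
    unfolding S'(2) by (rule hull_mono)
  moreover have "convex hull {v \<in> S. a \<bullet> v = b} \<subseteq> ?T"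
    using hull_subset[of S convex] by (intro hull_minimal) (auto simp: convex_Int convex_hyperplane)
  ultimately show eq: "?T = convex hull {v \<in> S. a \<bullet> v = b}" by blast
  show "convex hull {v \<in> S. a \<bullet> v = b} face_of convex hull S"
    using face unfolding eq .
qed

lemma norm_diff_sqr:
  fixes x y :: "'a::real_inner"
  shows "(norm (x - y))\<^sup>2 = (norm x)\<^sup>2 + (norm y)\<^sup>2 - 2 * (x \<bullet> y)"
  by (simp add: power2_norm_eq_inner inner_diff inner_commute)

text \<open>Among vectors of equal norm, the inner product with \<open>x\<close> is maximal at
  \<open>x\<close> alone, so the maximising face is a point.\<close>

lemma sphere_extreme_point:
  fixes S :: "'a::euclidean_space set"
  assumes "compact S" "\<And>v. v \<in> S \<Longrightarrow> norm v = r" "x \<in> S"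
  shows "x extreme_point_of convex hull S"
proof -
  have *: "x \<bullet> v = r\<^sup>2 - (norm (x - v))\<^sup>2 / 2" if "v \<in> S" for v
    using norm_diff_sqr[of x v] assms that by (simp add: field_simps)
  have "{v \<in> S. x \<bullet> v = r\<^sup>2} = {x}"
    using * assms(3) by auto
  moreover have "convex hull {v \<in> S. x \<bullet> v = r\<^sup>2} face_of convex hull S"
    using * by (intro convex_hull_Int_supporting_hyperplane assms) auto
  ultimately show ?thesis by (simp add: face_of_singleton)
qed

text \<open>On a sphere, maximising the inner product with \<open>x + y\<close> means minimising the sum of the squared
  distances to \<open>x\<close> and \<open>y\<close>.\<close>

lemma sphere_edge:
  fixes S :: "'a::euclidean_space set"
  assumes "compact S" "\<And>v. v \<in> S \<Longrightarrow> norm v = r" "x \<in> S" "y \<in> S" "x \<noteq> y"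
    and far: "\<And>v. v \<in> S \<Longrightarrow> v \<noteq> x \<Longrightarrow> v \<noteq> y \<Longrightarrow>
      (norm (x - y))\<^sup>2 < (norm (x - v))\<^sup>2 + (norm (y - v))\<^sup>2"
  shows "closed_segment x y edge_of convex hull S"
proof -
  let ?b = "2 * r\<^sup>2 - (norm (x - y))\<^sup>2 / 2"
  have *: "(x + y) \<bullet> v = 2 * r\<^sup>2 - ((norm (x - v))\<^sup>2 + (norm (y - v))\<^sup>2) / 2" if "v \<in> S" for v
    using norm_diff_sqr[of x v] norm_diff_sqr[of y v] assms that by (simp add: inner_add_left field_simps)
  have "(x + y) \<bullet> v \<le> ?b \<and> ((x + y) \<bullet> v = ?b \<longleftrightarrow> v = x \<or> v = y)" if "v \<in> S" for v
    using *[OF that] far[OF that] by (cases "v = x \<or> v = y") (auto simp: norm_minus_commute)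
  note b = this
  have "{v \<in> S. (x + y) \<bullet> v = ?b} = {x, y}"
    using b assms(3,4) by auto
  moreover have "convex hull {v \<in> S. (x + y) \<bullet> v = ?b} face_of convex hull S"
    using b by (intro convex_hull_Int_supporting_hyperplane assms) auto
  ultimately have "closed_segment x y face_of convex hull S"
    by (simp add: segment_convex_hull)
  moreover have "aff_dim (closed_segment x y) = 1"
    using assms(5) by (simp add: segment_convex_hull aff_dim_convex_hull aff_dim_2)
  ultimately show ?thesis unfolding edge_of_def by simp
qed

section \<open>Signed points and the distances between them\<close>

definition signed_labelling :: "('n::finite \<Rightarrow> real) \<Rightarrow> ('n \<Rightarrow> nat) \<Rightarrow> bool" where
  "signed_labelling s p \<longleftrightarrow> (\<forall>i. s i \<in> {-1, 1}) \<and> bij_betw p UNIV {1..CARD('n)}"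

definition signed_points :: "(real ^ 'n::finite) set" where
  "signed_points = {(\<chi> i. s i * real (p i)) | s p. signed_labelling s p}"

lemma B_permutahedron_eq: "B_permutahedron = convex hull signed_points"
  unfolding B_permutahedron_def signed_points_def signed_labelling_def by simp

lemma signed_labelling_range:
  fixes p :: "'n::finite \<Rightarrow> nat"
  assumes "signed_labelling s p"
  shows "1 \<le> p i" "p i \<le> CARD('n)" "\<bar>s i\<bar> = 1" "inj p"
proof -
  have "p i \<in> {1..CARD('n)}" "s i \<in> {-1, 1}" "inj p"
    using assms unfolding signed_labelling_def bij_betw_def by auto
  then show "1 \<le> p i" "p i \<le> CARD('n)" "\<bar>s i\<bar> = 1" "inj p" by auto
qed

lemma signed_points_coord:
  assumes "v \<in> signed_points"
  shows "v $ i \<in> \<int>" "1 \<le> \<bar>v $ i\<bar>" "\<bar>v $ i\<bar> = \<bar>v $ j\<bar> \<Longrightarrow> i = j"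
proof -
  obtain s p where v: "v = (\<chi> i. s i * real (p i))" "signed_labelling s p"
    using assms unfolding signed_points_def by auto
  note r = signed_labelling_range[OF v(2)]
  have "s i = -1 \<or> s i = 1" using v(2) unfolding signed_labelling_def by blast
  then have "s i \<in> \<int>" by auto
  then show "v $ i \<in> \<int>" unfolding v by simp
  show "1 \<le> \<bar>v $ i\<bar>" unfolding v using r(1,3)[of i] by (simp add: abs_mult)
  show "\<bar>v $ i\<bar> = \<bar>v $ j\<bar> \<Longrightarrow> i = j"
    unfolding v using r(3)[of i] r(3)[of j] r(4) by (simp add: abs_mult inj_eq)
qed

lemma norm_vec_sqr: "(norm (x :: real ^ 'n::finite))\<^sup>2 = (\<Sum>i\<in>UNIV. (x $ i)\<^sup>2)"
  unfolding power2_norm_eq_inner inner_vec_def by (simp add: power2_eq_square)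

lemma norm_signed_points:
  assumes "v \<in> (signed_points :: (real ^ 'n::finite) set)"
  shows "norm v = sqrt (\<Sum>k = 1..CARD('n). (real k)\<^sup>2)"
proof -
  obtain s p where v: "v = (\<chi> i. s i * real (p i))" "signed_labelling s p"
    using assms unfolding signed_points_def by auto
  have "(s i)\<^sup>2 = 1" for i using v(2) unfolding signed_labelling_def by (auto simp: power2_eq_1_iff)
  then have "(norm v)\<^sup>2 = (\<Sum>i\<in>UNIV. (real (p i))\<^sup>2)"
    unfolding norm_vec_sqr v by (simp add: power_mult_distrib)
  also have "\<dots> = (\<Sum>k = 1..CARD('n). (real k)\<^sup>2)"
    using v(2) unfolding signed_labelling_def
    by (intro sum.reindex_bij_betw[where g = "\<lambda>k. (real k)\<^sup>2"]) auto
  finally show ?thesis by (metis norm_ge_zero real_sqrt_unique)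
qed

lemma finite_signed_points: "finite (signed_points :: (real ^ 'n::finite) set)"
proof -
  let ?S = "PiE (UNIV :: 'n set) (\<lambda>_. {-1, 1 :: real})"
  let ?P = "PiE (UNIV :: 'n set) (\<lambda>_. {1..CARD('n)})"
  have "(signed_points :: (real ^ 'n) set) \<subseteq> (\<lambda>(s, p). \<chi> i. s i * real (p i)) ` (?S \<times> ?P)"
  proof
    fix v :: "real ^ 'n" assume "v \<in> signed_points"
    then obtain s p where v: "v = (\<chi> i. s i * real (p i))" "signed_labelling s p"
      unfolding signed_points_def by auto
    have "s \<in> ?S" "p \<in> ?P"
      using v(2) signed_labelling_range(1,2)[OF v(2)] unfolding signed_labelling_def by auto
    then show "v \<in> (\<lambda>(s, p). \<chi> i. s i * real (p i)) ` (?S \<times> ?P)" using v(1) by auto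
  qed
  then show ?thesis by (rule finite_subset) (intro finite_imageI finite_cartesian_product finite_PiE, auto)
qed

text \<open>At \<open>i\<close> and at \<open>j\<close>, the entries of \<open>x\<close> and
  \<open>y\<close> are consecutive integers, so the integer entry of \<open>v\<close> contributes at
  least 1 to the right-hand side at each of them, while the left-hand side is 2. It remains to
  exclude equality.\<close>

lemma swap_far:
  fixes x y v :: "real ^ 'n::finite"
  assumes "v \<in> signed_points" "v \<noteq> x" "v \<noteq> y" "i \<noteq> j" and st: "\<bar>\<sigma>\<bar> = 1" "\<bar>\<tau>\<bar> = 1"
    and xy: "x $ i = \<sigma> * real a" "y $ i = \<sigma> * (real a + 1)"
      "x $ j = \<tau> * (real a + 1)" "y $ j = \<tau> * real a" "\<And>k. k \<noteq> i \<Longrightarrow> k \<noteq> j \<Longrightarrow> x $ k = y $ k"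
  shows "(norm (x - y))\<^sup>2 < (norm (x - v))\<^sup>2 + (norm (y - v))\<^sup>2"
proof -
  have split: "(\<Sum>k\<in>UNIV. f k) = f i + f j + (\<Sum>k\<in>UNIV - {i, j}. f k)" for f :: "'n \<Rightarrow> real"
    using sum.subset_diff[of "{i, j}" UNIV f] \<open>i \<noteq> j\<close> by simp
  have sq: "\<sigma>\<^sup>2 = 1" "\<tau>\<^sup>2 = 1" using st by (auto simp: abs_square_eq_1)
  have "(norm (x - y))\<^sup>2 = 2"
    unfolding norm_vec_sqr split using sq xy by (simp add: power2_eq_square algebra_simps)
  \<comment> \<open>\<open>b\<close> and \<open>b + \<rho>\<close> are consecutive integers; an
    integer different from both has squared distances to them that sum to at least 2.\<close>
  moreover have "1 \<le> (b - v $ k)\<^sup>2 + (b + \<rho> - v $ k)\<^sup>2 \<and>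
    ((b - v $ k)\<^sup>2 + (b + \<rho> - v $ k)\<^sup>2 = 1 \<longrightarrow> v $ k = b \<or> v $ k = b + \<rho>)"
    if "b \<in> \<int>" "\<bar>\<rho>\<bar> = 1" for b \<rho> k
  proof -
    have "b - v $ k \<in> \<int>" "\<rho> \<in> \<int>"
      using that signed_points_coord(1)[OF assms(1)] by (auto simp: abs_if split: if_splits)
    then obtain m l where m: "b - v $ k = of_int m" "\<rho> = of_int l" by (metis Ints_cases)
    have l: "l = 1 \<or> l = -1" using that(2) m(2) by (auto simp: abs_if split: if_splits)
    have "1 \<le> m\<^sup>2 + (m + l)\<^sup>2 \<and> (m\<^sup>2 + (m + l)\<^sup>2 = 1 \<longrightarrow> m = 0 \<or> m = - l)"
    proof (cases "m = 0 \<or> m = - l")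
      case True
      then show ?thesis using l by auto
    next
      case False
      then have "m\<^sup>2 > 0" "(m + l)\<^sup>2 > 0" by auto
      then show ?thesis by linarith
    qed
    moreover have eq: "(b - v $ k)\<^sup>2 + (b + \<rho> - v $ k)\<^sup>2 = of_int (m\<^sup>2 + (m + l)\<^sup>2)"
    proof -
      have "b + \<rho> - v $ k = of_int (m + l)" using m by simp
      then show ?thesis using m(1) by simp
    qed
    moreover have "v $ k = b" if "m = 0" using m that by simp
    moreover have "v $ k = b + \<rho>" if "m = - l" using m that by simp
    ultimately show ?thesis unfolding eq of_int_1_le_iff of_int_eq_1_iff by blast
  qed
  note one = this
  have Z: "\<sigma> \<in> \<int>" "\<tau> \<in> \<int>" using st by (auto simp: abs_if split: if_splits)
  have i: "1 \<le> (x $ i - v $ i)\<^sup>2 + (y $ i - v $ i)\<^sup>2"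
    "(x $ i - v $ i)\<^sup>2 + (y $ i - v $ i)\<^sup>2 = 1 \<longrightarrow> v $ i = x $ i \<or> v $ i = y $ i"
    using one[of "\<sigma> * real a" \<sigma> i] st Z xy(1,2) by (auto simp: algebra_simps)
  have j: "1 \<le> (x $ j - v $ j)\<^sup>2 + (y $ j - v $ j)\<^sup>2"
    "(x $ j - v $ j)\<^sup>2 + (y $ j - v $ j)\<^sup>2 = 1 \<longrightarrow> v $ j = x $ j \<or> v $ j = y $ j"
    using one[of "\<tau> * real a" \<tau> j] st Z xy(3,4) by (auto simp: algebra_simps)
  let ?R = "\<Sum>k\<in>UNIV - {i, j}. (x $ k - v $ k)\<^sup>2 + (y $ k - v $ k)\<^sup>2"
  have D: "(norm (x - v))\<^sup>2 + (norm (y - v))\<^sup>2 =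
    ((x $ i - v $ i)\<^sup>2 + (y $ i - v $ i)\<^sup>2) + ((x $ j - v $ j)\<^sup>2 + (y $ j - v $ j)\<^sup>2) + ?R"
    unfolding norm_vec_sqr split by (simp add: sum.distrib)
  have R: "?R \<ge> 0" by (intro sum_nonneg) auto
  have "2 \<noteq> (norm (x - v))\<^sup>2 + (norm (y - v))\<^sup>2"
  proof
    assume "2 = (norm (x - v))\<^sup>2 + (norm (y - v))\<^sup>2"
    then have e: "(x $ i - v $ i)\<^sup>2 + (y $ i - v $ i)\<^sup>2 = 1" "(x $ j - v $ j)\<^sup>2 + (y $ j - v $ j)\<^sup>2 = 1" "?R = 0"
      using D R i(1) j(1) by linarith+
    have rest: "v $ k = x $ k \<and> v $ k = y $ k" if "k \<noteq> i" "k \<noteq> j" for k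
    proof -
      have "(x $ k - v $ k)\<^sup>2 + (y $ k - v $ k)\<^sup>2 = 0"
        using e(3) that by (subst (asm) sum_nonneg_eq_0_iff) auto
      then show ?thesis by (simp add: sum_power2_eq_zero_iff)
    qed
    have vi: "v $ i = x $ i \<or> v $ i = y $ i" and vj: "v $ j = x $ j \<or> v $ j = y $ j"
      using e i j by auto
    \<comment> \<open>The mixed choices, one entry from \<open>x\<close> and one from
      \<open>y\<close>, would give equal absolute values at \<open>i\<close> and
      \<open>j\<close>.\<close>
    have "\<bar>v $ i\<bar> \<noteq> \<bar>v $ j\<bar>" using signed_points_coord(3)[OF assms(1)] \<open>i \<noteq> j\<close> by blast
    then have "v $ i = x $ i \<and> v $ j = x $ j \<or> v $ i = y $ i \<and> v $ j = y $ j"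
      using vi vj xy st by (auto simp: abs_mult)
    then have "v = x \<or> v = y" using rest by (metis vec_eq_iff)
    then show False using assms by blast
  qed
  ultimately show ?thesis using D R i(1) j(1) by linarith
qed

text \<open>The left-hand side is 4. Opposite entries of modulus 1 at \<open>i\<close> contribute
  \<open>2 * (v $ i)^2 + 2\<close> on the right, which is at least 4 because entries of signed
  points have modulus at least 1.\<close>

lemma flip_far:
  fixes x y v :: "real ^ 'n::finite"
  assumes "v \<in> signed_points" "v \<noteq> x" "v \<noteq> y"
    and xy: "\<bar>x $ i\<bar> = 1" "y $ i = - x $ i" "\<And>k. k \<noteq> i \<Longrightarrow> x $ k = y $ k"
  shows "(norm (x - y))\<^sup>2 < (norm (x - v))\<^sup>2 + (norm (y - v))\<^sup>2"
proof -
  have split: "(\<Sum>k\<in>UNIV. f k) = f i + (\<Sum>k\<in>UNIV - {i}. f k)" for f :: "'n \<Rightarrow> real"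
    using sum.remove[of UNIV i f] by simp
  have sq: "(x $ i)\<^sup>2 = 1" using xy(1) by (simp add: abs_square_eq_1)
  have xy4: "(norm (x - y))\<^sup>2 = 4"
    unfolding norm_vec_sqr split using sq xy by (simp add: power2_eq_square algebra_simps)
  let ?R = "\<Sum>k\<in>UNIV - {i}. (x $ k - v $ k)\<^sup>2 + (y $ k - v $ k)\<^sup>2"
  have "(norm (x - v))\<^sup>2 + (norm (y - v))\<^sup>2 =
    ((x $ i - v $ i)\<^sup>2 + (y $ i - v $ i)\<^sup>2) + ?R"
    unfolding norm_vec_sqr split by (simp add: sum.distrib)
  also have "(x $ i - v $ i)\<^sup>2 + (y $ i - v $ i)\<^sup>2 = 2 * (v $ i)\<^sup>2 + 2"
    using sq xy by (simp add: power2_eq_square algebra_simps)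
  finally have D: "(norm (x - v))\<^sup>2 + (norm (y - v))\<^sup>2 = 2 * (v $ i)\<^sup>2 + 2 + ?R" .
  have v1: "1 \<le> (v $ i)\<^sup>2" using signed_points_coord(2)[OF assms(1), of i]
    by (metis abs_1 abs_le_square_iff one_power2)
  have R: "?R \<ge> 0" by (intro sum_nonneg) auto
  have "4 \<noteq> (norm (x - v))\<^sup>2 + (norm (y - v))\<^sup>2"
  proof
    assume "4 = (norm (x - v))\<^sup>2 + (norm (y - v))\<^sup>2"
    then have e: "(v $ i)\<^sup>2 = 1" "?R = 0" using D R v1 by linarith+
    have rest: "v $ k = x $ k \<and> v $ k = y $ k" if "k \<noteq> i" for k
    proof -
      have "(x $ k - v $ k)\<^sup>2 + (y $ k - v $ k)\<^sup>2 = 0"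
        using e(2) that by (subst (asm) sum_nonneg_eq_0_iff) auto
      then show ?thesis by (simp add: sum_power2_eq_zero_iff)
    qed
    have "v $ i = x $ i \<or> v $ i = y $ i" using e(1) xy sq by (metis power2_eq_iff)
    then have "v = x \<or> v = y" using rest by (metis vec_eq_iff)
    then show False using assms by blast
  qed
  then show ?thesis using D R v1 xy4 by linarith
qed

section \<open>Maximisers of linear functionals and facets\<close>

lemma signed_labelling_transpose:
  "signed_labelling s p \<Longrightarrow> signed_labelling s (p \<circ> Transposition.transpose i j)"
  unfolding signed_labelling_def
  using bij_betw_trans[OF bij_transpose[of i j], of p] by simp

text \<open>An exchange argument: neither flipping one sign nor transposing two labels can increase
  the inner product. The first fixes the signs, the second forces every label outside
  \<open>A\<close> below every label in \<open>A\<close>.\<close>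

lemma optimal_labelling:
  fixes a :: "real ^ 'n::finite"
  assumes sp: "signed_labelling s p"
    and opt: "\<And>v. v \<in> signed_points \<Longrightarrow> a \<bullet> v \<le> a \<bullet> (\<chi> i. s i * real (p i))"
    and dom: "\<And>i j. i \<in> A \<Longrightarrow> j \<notin> A \<Longrightarrow> \<bar>a $ j\<bar> < \<bar>a $ i\<bar>" and nz: "\<And>i. i \<in> A \<Longrightarrow> a $ i \<noteq> 0"
    and i: "i \<in> A"
  shows "s i = sgn (a $ i)" "CARD('n) < p i + card A"
proof -
  have opt': "(\<Sum>k\<in>UNIV. a $ k * (s' k * real (p' k))) \<le> (\<Sum>k\<in>UNIV. a $ k * (s k * real (p k)))"
    if "signed_labelling s' p'" for s' p'
    using opt[of "\<chi> i. s' i * real (p' i)"] that unfolding signed_points_def inner_vec_def by auto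
  have nonneg: "0 \<le> a $ k * s k" for k
  proof -
    have "signed_labelling (s(k := - s k)) p" using sp unfolding signed_labelling_def by auto
    from opt'[OF this] have "0 \<le> (\<Sum>l\<in>UNIV. a $ l * (s l * real (p l)) -
       a $ l * ((s(k := - s k)) l * real (p l)))"
      by (simp add: sum_subtractf)
    also have "\<dots> = (\<Sum>l\<in>UNIV. if l = k then 2 * (a $ l * s l) * real (p l) else 0)"
      by (intro sum.cong) auto
    finally have "0 \<le> (a $ k * s k) * real (p k)" by (simp add: mult_ac)
    then show ?thesis using signed_labelling_range(1)[OF sp, of k] by (simp add: zero_le_mult_iff)
  qed
  have abs: "a $ k * s k = \<bar>a $ k\<bar>" for k
    using nonneg[of k] signed_labelling_range(3)[OF sp, of k] by (metis abs_mult abs_of_nonneg mult.right_neutral)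
  show "s i = sgn (a $ i)"
    using abs[of i] nz[OF i] sp unfolding signed_labelling_def by (auto simp: sgn_if abs_if split: if_splits)
  have lt: "p j < p i" if j: "j \<notin> A" for j
  proof (rule ccontr)
    assume "\<not> p j < p i"
    moreover have "i \<noteq> j" using i j by blast
    ultimately have pij: "p i < p j"
      using signed_labelling_range(4)[OF sp] by (metis injD linorder_neqE_nat)
    let ?q = "p \<circ> Transposition.transpose i j"
    have "0 \<le> (\<Sum>l\<in>UNIV. a $ l * (s l * real (p l)) - a $ l * (s l * real (?q l)))"
      using opt'[OF signed_labelling_transpose[OF sp]] by (simp add: sum_subtractf)
    also have "\<dots> = (\<Sum>l\<in>UNIV. (if l = i then (a $ l * s l) * (real (p i) - real (p j)) else 0) +
        (if l = j then (a $ l * s l) * (real (p j) - real (p i)) else 0))"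
      using \<open>i \<noteq> j\<close> by (intro sum.cong) (auto simp: transpose_def algebra_simps)
    also have "\<dots> = (\<bar>a $ j\<bar> - \<bar>a $ i\<bar>) * (real (p j) - real (p i))"
      unfolding abs by (simp add: sum.distrib algebra_simps)
    finally show False using pij dom[OF i j] by (simp add: zero_le_mult_iff)
  qed
  \<comment> \<open>All \<open>CARD('n) - card A\<close> labels outside \<open>A\<close> fit below
    \<open>p i\<close>, which bounds \<open>p i\<close> from below.\<close>
  have "p ` (- A) \<subseteq> {1..<p i}" using lt signed_labelling_range(1)[OF sp] by auto
  then have "card (p ` (- A)) \<le> p i - 1" using card_mono[of "{1..<p i}"] by force
  moreover have "card (p ` (- A)) = CARD('n) - card A"
    using signed_labelling_range(4)[OF sp] by (simp add: card_image inj_on_subset Compl_eq_Diff_UNIV card_Diff_subset)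
  ultimately show "CARD('n) < p i + card A"
    using signed_labelling_range(1)[OF sp, of i] by linarith
qed

text \<open>If \<open>F\<close> is cut out by \<open>a\<close>, then it is contained in the proper face \<open>G\<close> cut out by the signs of
  the coordinates of \<open>a\<close> of maximal modulus, and a facet has to coincide with \<open>G\<close>.\<close>

lemma facet_of_B_permutahedron:
  fixes F :: "(real ^ 'n::finite) set"
  assumes F: "F facet_of B_permutahedron"
  obtains A \<epsilon> where "A \<noteq> {}" "\<And>i. i \<in> A \<Longrightarrow> \<epsilon> i \<in> {-1, 1}"
    "\<And>s p. signed_labelling s p \<Longrightarrow>
      (\<chi> i. s i * real (p i)) \<in> F \<longleftrightarrow> (\<forall>i\<in>A. s i = \<epsilon> i \<and> CARD('n) < p i + card A)"
proof -
  let ?V = "signed_points :: (real ^ 'n) set" and ?P = "B_permutahedron :: (real ^ 'n) set"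
  have comp: "compact ?V" using finite_signed_points by (rule finite_imp_compact)
  have "polyhedron ?P"
    unfolding B_permutahedron_eq using finite_signed_points polyhedron_convex_hull by blast
  then obtain a b where ab: "a \<noteq> 0" "?P \<subseteq> {x. a \<bullet> x \<le> b}" "F = ?P \<inter> {x. a \<bullet> x = b}"
    using facet_of_polyhedron F by metis
  have VP: "?V \<subseteq> ?P" unfolding B_permutahedron_eq by (rule hull_subset)
  define \<mu> where "\<mu> = Max (range (\<lambda>i. \<bar>a $ i\<bar>))"
  define A where "A = {i. \<bar>a $ i\<bar> = \<mu>}"
  define C where "C = (\<lambda>s p. \<forall>i\<in>A. s i = sgn (a $ i) \<and> CARD('n) < p i + card A)"
  \<comment> \<open>The normal vector of \<open>G\<close>: on \<open>A\<close> it keeps the signs of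
    \<open>a\<close> and forgets the sizes.\<close>
  define \<alpha> :: "real ^ 'n" where "\<alpha> = (\<chi> i. if i \<in> A then sgn (a $ i) else 0)"
  have le_mu: "\<bar>a $ i\<bar> \<le> \<mu>" for i unfolding \<mu>_def by (intro Max_ge) auto
  have "\<mu> \<in> range (\<lambda>i. \<bar>a $ i\<bar>)" unfolding \<mu>_def by (intro Max_in) auto
  then have Ane: "A \<noteq> {}" unfolding A_def by auto
  obtain k where "a $ k \<noteq> 0" using ab(1) by (auto simp: vec_eq_iff)
  then have mu: "\<mu> > 0" using le_mu[of k] by linarith
  have nz: "a $ i \<noteq> 0" if "i \<in> A" for i using that mu unfolding A_def by auto
  have dom: "\<bar>a $ j\<bar> < \<bar>a $ i\<bar>" if "i \<in> A" "j \<notin> A" for i j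
    using that le_mu[of j] unfolding A_def by auto
  \<comment> \<open>The value of \<open>\<alpha>\<close> at points where \<open>A\<close> carries
    the \<open>card A\<close> largest labels with the signs of \<open>a\<close>.\<close>
  define M where "M = (\<Sum>k = CARD('n) - card A + 1..CARD('n). real k)"
  have C_M: "\<alpha> \<bullet> (\<chi> i. s i * real (p i)) = M" if "signed_labelling s p" "C s p" for s p
  proof -
    have "p ` A \<subseteq> {CARD('n) - card A + 1..CARD('n)}"
    proof (rule image_subsetI)
      fix i assume "i \<in> A"
      then have "CARD('n) < p i + card A" using that(2) unfolding C_def by blast
      then show "p i \<in> {CARD('n) - card A + 1..CARD('n)}"
        using signed_labelling_range(1,2)[OF that(1), of i] by auto
    qed
    moreover have inj: "inj_on p A" using signed_labelling_range(4)[OF that(1)] by (rule inj_on_subset) simp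
    moreover have "card A \<le> CARD('n)" by (simp add: card_mono)
    ultimately have pA: "p ` A = {CARD('n) - card A + 1..CARD('n)}"
      by (intro card_subset_eq) (auto simp: card_image)
    have "\<alpha> \<bullet> (\<chi> i. s i * real (p i)) = (\<Sum>i\<in>UNIV. if i \<in> A then real (p i) else 0)"
      unfolding inner_vec_def \<alpha>_def using that(2) nz unfolding C_def
      by (intro sum.cong) (auto simp: sgn_if)
    also have "\<dots> = (\<Sum>i\<in>A. real (p i))" by (simp add: sum.If_cases)
    also have "\<dots> = M" unfolding M_def pA[symmetric] using inj by (simp add: sum.reindex)
    finally show ?thesis .
  qed
  have C_alpha: "C s p" if "signed_labelling s p"
    "\<And>v. v \<in> ?V \<Longrightarrow> \<alpha> \<bullet> v \<le> \<alpha> \<bullet> (\<chi> i. s i * real (p i))" for s p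
  proof -
    have "s i = sgn (\<alpha> $ i) \<and> CARD('n) < p i + card A" if "i \<in> A" for i
    proof -
      have 1: "\<bar>\<alpha> $ l\<bar> < \<bar>\<alpha> $ j\<bar>" if "j \<in> A" "l \<notin> A" for j l
        using that nz unfolding \<alpha>_def by (auto simp: sgn_if)
      have 2: "\<alpha> $ j \<noteq> 0" if "j \<in> A" for j
        using that nz unfolding \<alpha>_def by (auto simp: sgn_if)
      show ?thesis
        using optimal_labelling[OF \<open>signed_labelling s p\<close> \<open>\<And>v. v \<in> ?V \<Longrightarrow> _ v\<close> 1 2 \<open>i \<in> A\<close>] by blast
    qed
    then show ?thesis unfolding C_def \<alpha>_def by simp
  qed
  obtain S' where S': "S' \<subseteq> ?V" "F = convex hull S'"
    using face_of_convex_hull_subset[OF comp] F facet_of_imp_face_of unfolding B_permutahedron_eq by metis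
  have "F \<noteq> {}" using F unfolding facet_of_def by simp
  then obtain v0 where v0: "v0 \<in> S'" using S'(2) by fastforce
  have F_C: "C s p" if "signed_labelling s p" "(\<chi> i. s i * real (p i)) \<in> F" for s p
  proof -
    have "a \<bullet> v \<le> a \<bullet> (\<chi> i. s i * real (p i))" if "v \<in> ?V" for v
      using ab VP \<open>_ \<in> F\<close> that by auto
    from optimal_labelling[OF \<open>signed_labelling s p\<close> this dom nz] show ?thesis
      unfolding C_def by blast
  qed
  obtain v1 where v1: "v1 \<in> ?V" "\<And>v. v \<in> ?V \<Longrightarrow> \<alpha> \<bullet> v \<le> \<alpha> \<bullet> v1"
  proof -
    have "?V \<noteq> {}" using v0 S' by blast
    moreover have "continuous_on ?V (\<lambda>v. \<alpha> \<bullet> v)" by (intro continuous_intros)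
    ultimately show thesis using continuous_attains_sup[OF comp] that by blast
  qed
  \<comment> \<open>The maximiser \<open>v1\<close> satisfies \<open>C\<close> by the exchange
    argument for \<open>\<alpha>\<close>; so \<open>M\<close> is the maximum, attained exactly under
    \<open>C\<close>.\<close>
  have alpha_v1: "\<alpha> \<bullet> v1 = M"
    using v1 C_M C_alpha unfolding signed_points_def by blast
  have alpha_iff: "\<alpha> \<bullet> (\<chi> i. s i * real (p i)) = M \<longleftrightarrow> C s p" if "signed_labelling s p" for s p
    using C_M[OF that] C_alpha[OF that] v1(2) alpha_v1 by metis
  define G where "G = ?P \<inter> {x. \<alpha> \<bullet> x = M}"
  have G: "G face_of ?P" "convex G"
    using convex_hull_Int_supporting_hyperplane[OF comp, of \<alpha> M] v1(2) alpha_v1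
    unfolding G_def B_permutahedron_eq by (auto simp: face_of_imp_convex)
  have "S' \<subseteq> G"
  proof
    fix v assume v: "v \<in> S'"
    then obtain s p where sp: "v = (\<chi> i. s i * real (p i))" "signed_labelling s p"
      using S' unfolding signed_points_def by blast
    have "v \<in> F" using v S' hull_subset[of S' convex] by auto
    then show "v \<in> G" using F_C[OF sp(2)] C_M[OF sp(2)] v S' VP unfolding G_def sp(1) by auto
  qed
  then have FG: "F \<subseteq> G" unfolding S'(2) using G(2) by (rule hull_minimal)
  \<comment> \<open>Negating a vertex keeps its labels and reverses all signs, so a vertex and its
    antipode cannot both satisfy \<open>C\<close>.\<close>
  have "G \<noteq> ?P"
  proof
    assume GP: "G = ?P"
    obtain s p where sp: "v0 = (\<chi> i. s i * real (p i))" "signed_labelling s p"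
      using v0 S' unfolding signed_points_def by blast
    have neg: "signed_labelling (\<lambda>i. - s i) p" using sp(2) unfolding signed_labelling_def by auto
    have "(\<chi> i. s i * real (p i)) \<in> G" "(\<chi> i. - s i * real (p i)) \<in> G"
      using GP VP sp(2) neg unfolding signed_points_def by blast+
    then have "C s p" "C (\<lambda>i. - s i) p"
      using alpha_iff[OF sp(2)] alpha_iff[OF neg] unfolding G_def by auto
    then obtain i where "s i = - s i" using Ane unfolding C_def by fastforce
    then show False using signed_labelling_range(3)[OF sp(2), of i] by simp
  qed
  have "F = G"
  proof (rule ccontr)
    assume "F \<noteq> G"
    have "F face_of G"
      using F FG G(1) by (meson face_of_imp_subset face_of_subset facet_of_imp_face_of)
    then have "aff_dim F < aff_dim G" using \<open>F \<noteq> G\<close> G(2) face_of_aff_dim_lt by blast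
    moreover have "aff_dim G < aff_dim ?P"
      using G(1) \<open>G \<noteq> ?P\<close> unfolding B_permutahedron_eq by (intro face_of_aff_dim_lt) auto
    ultimately show False using F unfolding facet_of_def by linarith
  qed
  then have "(\<chi> i. s i * real (p i)) \<in> F \<longleftrightarrow> C s p" if "signed_labelling s p" for s p
    using alpha_iff[OF that] that VP unfolding G_def signed_points_def by blast
  moreover have "sgn (a $ i) \<in> {-1, 1}" if "i \<in> A" for i using nz[OF that] by (simp add: sgn_if)
  ultimately show thesis using that[of A "\<lambda>i. sgn (a $ i)"] Ane unfolding C_def by blast
qed

subsection \<open>Words as vertices\<close>

definition sign_of :: "bool \<Rightarrow> real" where
  "sign_of b = (if b then 1 else - 1)"

text \<open>The \<open>k\<close>-th letter, counted from 0, names the coordinate with absolute value \<open>length w - k\<close>, so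
  prefixes collect the largest entries.\<close>

definition word_vec :: "('n::finite \<times> bool) list \<Rightarrow> real ^ 'n" where
  "word_vec w = (\<chi> i. \<Sum>k<length w.
     if fst (w ! k) = i then sign_of (snd (w ! k)) * real (length w - k) else 0)"

lemma abs_sign_of [simp]: "\<bar>sign_of b\<bar> = 1"
  unfolding sign_of_def by simp

lemma sign_of_eq_iff [simp]: "sign_of b = sign_of b' \<longleftrightarrow> b = b'"
  unfolding sign_of_def by simp

lemma signed_perm_length: "signed_perm (UNIV :: 'n::finite set) w \<Longrightarrow> length w = CARD('n)"
  using distinct_card[of "map fst w"] unfolding signed_perm_def by simp

lemma signed_perm_index:
  assumes "signed_perm (UNIV :: 'n set) w"
  obtains k where "k < length w" "fst (w ! k) = i"
proof -
  have "i \<in> fst ` set w" using assms unfolding signed_perm_def by simp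
  then show thesis using that by (auto simp: in_set_conv_nth)
qed

lemma signed_perm_index_inj:
  assumes "signed_perm X w" "fst (w ! k) = fst (w ! l)" "k < length w" "l < length w"
  shows "k = l"
  using assms nth_eq_iff_index_eq[of "map fst w" k l] unfolding signed_perm_def by simp

lemma word_vec_nth:
  assumes "signed_perm UNIV w" "k < length w"
  shows "word_vec w $ fst (w ! k) = sign_of (snd (w ! k)) * real (length w - k)"
proof -
  have "word_vec w $ fst (w ! k) =
    (\<Sum>l<length w. if l = k then sign_of (snd (w ! k)) * real (length w - k) else 0)"
    unfolding word_vec_def vec_lambda_beta
    using signed_perm_index_inj[OF assms(1)] assms(2) by (intro sum.cong) auto
  then show ?thesis using assms(2) by simp
qed

lemma word_vec_labelling:
  fixes w :: "('n::finite \<times> bool) list"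
  assumes w: "signed_perm UNIV w"
  obtains s p where "signed_labelling s p" "word_vec w = (\<chi> i. s i * real (p i))"
    "\<And>k. k < length w \<Longrightarrow> s (fst (w ! k)) = sign_of (snd (w ! k)) \<and> p (fst (w ! k)) = length w - k"
proof -
  have "\<forall>i. \<exists>k. k < length w \<and> fst (w ! k) = i" using signed_perm_index[OF w] by metis
  then obtain idx where idx: "\<And>i. idx i < length w" "\<And>i. fst (w ! idx i) = i" by metis
  have idx_fst: "idx (fst (w ! k)) = k" if "k < length w" for k
    using signed_perm_index_inj[OF w] idx that by blast
  define s where "s = (\<lambda>i. sign_of (snd (w ! idx i)))"
  define p where "p = (\<lambda>i. length w - idx i)"
  have "inj p"
  proof (rule injI)
    fix i j assume "p i = p j"
    then have "idx i = idx j" using idx(1)[of i] idx(1)[of j] unfolding p_def by linarith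
    then show "i = j" using idx(2) by metis
  qed
  moreover have "range p \<subseteq> {1..CARD('n)}"
    using idx(1) signed_perm_length[OF w] unfolding p_def by (auto simp: Suc_le_eq)
  ultimately have "bij_betw p UNIV {1..CARD('n)}"
    unfolding bij_betw_def by (intro conjI card_subset_eq) (auto simp: card_image)
  then have "signed_labelling s p"
    unfolding signed_labelling_def s_def sign_of_def by simp
  moreover have "word_vec w = (\<chi> i. s i * real (p i))"
    unfolding vec_eq_iff vec_lambda_beta s_def p_def
    using word_vec_nth[OF w idx(1)] idx(2) by simp
  moreover have "s (fst (w ! k)) = sign_of (snd (w ! k)) \<and> p (fst (w ! k)) = length w - k"
    if "k < length w" for k
    using idx_fst[OF that] unfolding s_def p_def by simp
  ultimately show thesis using that by blast
qed

lemma word_vec_signed_points: "signed_perm UNIV w \<Longrightarrow> word_vec w \<in> signed_points"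
  using word_vec_labelling[of w] unfolding signed_points_def by blast

lemma word_vec_inj:
  fixes w w' :: "('n::finite \<times> bool) list"
  assumes w: "signed_perm UNIV w" and w': "signed_perm UNIV w'" and eq: "word_vec w = word_vec w'"
  shows "w = w'"
proof (rule nth_equalityI)
  show len: "length w = length w'" using signed_perm_length w w' by metis
  fix k assume k: "k < length w"
  obtain l where l: "l < length w'" "fst (w' ! l) = fst (w ! k)"
    using signed_perm_index[OF w'] by metis
  have *: "sign_of (snd (w ! k)) * real (length w - k) = sign_of (snd (w' ! l)) * real (length w - l)"
    using word_vec_nth[OF w k] word_vec_nth[OF w' l(1)] l(2) eq len by simp
  then have "real (length w - k) = real (length w - l)"
    by (metis abs_mult abs_of_nat abs_sign_of mult_1)
  then have lk: "l = k" using k l(1) len by simp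
  then have "snd (w ! k) = snd (w' ! k)" using * k by simp
  then show "w ! k = w' ! k" using l(2) lk by (simp add: prod_eq_iff)
qed

text \<open>Swapped letters carry consecutive absolute values and the last letter carries 1, so the
  distance estimates show that no third vertex lies on the face maximising the inner product with
  the sum of the two ends.\<close>

lemma word_adj_edge:
  fixes w w' :: "('n::finite \<times> bool) list"
  assumes w: "signed_perm UNIV w" and adj: "word_adj w w'"
  shows "closed_segment (word_vec w) (word_vec w') edge_of B_permutahedron"
proof -
  let ?x = "word_vec w" and ?y = "word_vec w'"
  have w': "signed_perm UNIV w'" using word_adj_signed_perm[OF adj w] .
  have len: "length w' = length w" using word_adj_length[OF adj] .
  have same: "?x $ m = ?y $ m" if "k < length w" "fst (w ! k) = m" "w' ! k = w ! k" for k m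
    using word_vec_nth[OF w, of k] word_vec_nth[OF w', of k] that len by simp
  have "?x \<noteq> ?y \<and> (\<forall>v\<in>signed_points. v \<noteq> ?x \<longrightarrow> v \<noteq> ?y \<longrightarrow>
    (norm (?x - ?y))\<^sup>2 < (norm (?x - v))\<^sup>2 + (norm (?y - v))\<^sup>2)"
    using adj unfolding word_adj_def
  proof
    assume "swap_adj w w'"
    then obtain r a b t where ww: "w = r @ [a, b] @ t" "w' = r @ [b, a] @ t"
      unfolding swap_adj_def by blast
    have ne: "fst b \<noteq> fst a" using w unfolding ww signed_perm_def by auto
    \<comment> \<open>The letters of \<open>t\<close> take the absolute values up to
      \<open>length t\<close>; in \<open>w\<close>, \<open>b\<close> and then \<open>a\<close> carry
      the next two.\<close>
    have x: "?x $ fst a = sign_of (snd a) * (real (Suc (length t)) + 1)"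
      "?x $ fst b = sign_of (snd b) * real (Suc (length t))"
      using word_vec_nth[OF w, of "length r"] word_vec_nth[OF w, of "Suc (length r)"]
      by (simp_all add: ww nth_append Suc_diff_le)
    have y: "?y $ fst b = sign_of (snd b) * (real (Suc (length t)) + 1)"
      "?y $ fst a = sign_of (snd a) * real (Suc (length t))"
      using word_vec_nth[OF w', of "length r"] word_vec_nth[OF w', of "Suc (length r)"]
      by (simp_all add: ww nth_append Suc_diff_le)
    have rest: "?x $ m = ?y $ m" if m: "m \<noteq> fst b" "m \<noteq> fst a" for m
    proof -
      obtain k where k: "k < length w" "fst (w ! k) = m" using signed_perm_index[OF w] by metis
      have "k \<noteq> length r" "k \<noteq> Suc (length r)" using k(2) m by (auto simp: ww nth_append)
      then have "w' ! k = w ! k"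
        by (auto simp: ww nth_append nth_Cons' not_less Suc_le_eq)
      then show ?thesis by (rule same[OF k])
    qed
    have "?x $ fst a \<noteq> ?y $ fst a" unfolding x y by (simp add: sign_of_def)
    then have "?x \<noteq> ?y" by metis
    moreover have "(norm (?x - ?y))\<^sup>2 < (norm (?x - v))\<^sup>2 + (norm (?y - v))\<^sup>2"
      if "v \<in> signed_points" "v \<noteq> ?x" "v \<noteq> ?y" for v
      by (rule swap_far[OF that ne abs_sign_of abs_sign_of x(2) y(1) x(1) y(2) rest])
    ultimately show ?thesis by blast
  next
    assume "flip_last w w'"
    then obtain r i \<sigma> where ww: "w = r @ [(i, \<sigma>)]" "w' = r @ [(i, \<not> \<sigma>)]"
      unfolding flip_last_def by blast
    have x: "?x $ i = sign_of \<sigma>" using word_vec_nth[OF w, of "length r"] by (simp add: ww)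
    have "?y $ i = sign_of (\<not> \<sigma>)" using word_vec_nth[OF w', of "length r"] by (simp add: ww)
    then have y: "?y $ i = - ?x $ i" unfolding x by (simp add: sign_of_def)
    have rest: "?x $ m = ?y $ m" if m: "m \<noteq> i" for m
    proof -
      obtain k where k: "k < length w" "fst (w ! k) = m" using signed_perm_index[OF w] by metis
      have "k \<noteq> length r" using k(2) m by (auto simp: ww)
      then have "w' ! k = w ! k" using k(1) by (auto simp: ww nth_append)
      then show ?thesis by (rule same[OF k])
    qed
    have "?x $ i \<noteq> ?y $ i" unfolding y x by (simp add: sign_of_def)
    then have "?x \<noteq> ?y" by metis
    moreover have "(norm (?x - ?y))\<^sup>2 < (norm (?x - v))\<^sup>2 + (norm (?y - v))\<^sup>2"
      if "v \<in> signed_points" "v \<noteq> ?x" "v \<noteq> ?y" for v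
      by (rule flip_far[OF that _ y rest]) (simp add: x)
    ultimately show ?thesis by blast
  qed
  then show ?thesis
    unfolding B_permutahedron_eq
    by (intro sphere_edge[OF finite_imp_compact[OF finite_signed_points] norm_signed_points])
      (use word_vec_signed_points w w' in auto)
qed

lemma word_vec_vertex:
  "signed_perm UNIV w \<Longrightarrow> word_vec w \<in> skeleton_verts B_permutahedron"
  unfolding skeleton_verts_def B_permutahedron_eq
  using sphere_extreme_point[OF finite_imp_compact[OF finite_signed_points] norm_signed_points]
    word_vec_signed_points by blast

text \<open>On the facet, the indices of \<open>A\<close> carry the \<open>card A\<close> largest
  labels with prescribed signs. Since letters are ordered by decreasing label, this says that these
  signed indices fill the first \<open>card A\<close> positions.\<close>

lemma facet_prefix_set:
  fixes F :: "(real ^ 'n::finite) set"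
  assumes "F facet_of B_permutahedron"
  obtains c where "c \<in> signed_sets (UNIV :: 'n set)" "c \<noteq> {}"
    "\<And>w. signed_perm UNIV w \<Longrightarrow> word_vec w \<in> F \<longleftrightarrow> c \<in> prefix_sets w"
proof -
  obtain A \<epsilon> where A: "A \<noteq> {}" "\<And>i. i \<in> A \<Longrightarrow> \<epsilon> i \<in> {-1, 1}"
    "\<And>s p. signed_labelling s p \<Longrightarrow>
      (\<chi> i. s i * real (p i)) \<in> F \<longleftrightarrow> (\<forall>i\<in>A. s i = \<epsilon> i \<and> CARD('n) < p i + card A)"
    using facet_of_B_permutahedron[OF assms] by blast
  define c where "c = (\<lambda>i. (i, \<epsilon> i = 1)) ` A"
  have card_c: "card c = card A" unfolding c_def by (intro card_image inj_onI) simp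
  have sign: "sign_of (\<epsilon> i = 1) = \<epsilon> i" if "i \<in> A" for i
    using A(2)[OF that] unfolding sign_of_def by auto
  have A1: "1 \<le> card A" using A(1) by (simp add: Suc_le_eq card_gt_0_iff)
  have An: "card A \<le> CARD('n)" by (simp add: card_mono)
  have "word_vec w \<in> F \<longleftrightarrow> c \<in> prefix_sets w" if w: "signed_perm UNIV w" for w
  proof -
    obtain s p where sp: "signed_labelling s p" "word_vec w = (\<chi> i. s i * real (p i))"
      "\<And>k. k < length w \<Longrightarrow> s (fst (w ! k)) = sign_of (snd (w ! k)) \<and> p (fst (w ! k)) = length w - k"
      using word_vec_labelling[OF w] by blast
    have len: "length w = CARD('n)" using signed_perm_length[OF w] .
    have dist: "distinct w" using w unfolding signed_perm_def by (simp add: distinct_map)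
    have card_take: "card (set (take k w)) = k" if "k \<le> length w" for k
      using distinct_card[OF distinct_take[OF dist], of k] that by simp
    show ?thesis
    proof
      assume "word_vec w \<in> F"
      then have C: "s i = \<epsilon> i" "CARD('n) < p i + card A" if "i \<in> A" for i
        using A(3)[OF sp(1)] sp(2) that by auto
      \<comment> \<open>Inclusion is enough, as both sets have \<open>card A\<close>
        elements.\<close>
      have "c \<subseteq> set (take (card A) w)"
      proof
        fix z assume "z \<in> c"
        then obtain i where i: "i \<in> A" "z = (i, \<epsilon> i = 1)" unfolding c_def by blast
        obtain k where k: "k < length w" "fst (w ! k) = i" using signed_perm_index[OF w] by metis
        have "k < card A" using sp(3)[OF k(1)] C(2)[OF i(1)] k len by simp
        moreover have "snd (w ! k) = (\<epsilon> i = 1)"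
          using sp(3)[OF k(1)] C(1)[OF i(1)] sign[OF i(1)] k(2) by (metis sign_of_eq_iff)
        ultimately show "z \<in> set (take (card A) w)"
          using i(2) k by (auto simp: in_set_conv_nth intro!: exI[of _ k] prod_eqI)
      qed
      then have "c = set (take (card A) w)"
        using card_c card_take An len by (intro card_subset_eq) auto
      then show "c \<in> prefix_sets w" unfolding prefix_sets_def using A1 An len by auto
    next
      assume "c \<in> prefix_sets w"
      then obtain k where k: "1 \<le> k" "k \<le> length w" "c = set (take k w)"
        unfolding prefix_sets_def by auto
      then have kA: "k = card A" using card_take[OF k(2)] card_c by simp
      have "s i = \<epsilon> i \<and> CARD('n) < p i + card A" if "i \<in> A" for i
      proof -
        have "(i, \<epsilon> i = 1) \<in> set (take k w)" using that k(3) unfolding c_def by blast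
        then obtain l where l: "l < k" "l < length w" "w ! l = (i, \<epsilon> i = 1)"
          by (auto simp: in_set_conv_nth)
        then show ?thesis using sp(3)[OF l(2)] sign[OF that] len kA by simp
      qed
      then show "word_vec w \<in> F" using A(3)[OF sp(1)] sp(2) by simp
    qed
  qed
  moreover have "c \<in> signed_sets UNIV" unfolding signed_sets_def c_def by (auto simp: inj_on_def)
  moreover have "c \<noteq> {}" using A(1) unfolding c_def by simp
  ultimately show thesis using that by blast
qed

section \<open>Transfer of the cycle of words to the skeleton\<close>

theorem theorem10:
  assumes "CARD('n::finite) \<ge> 2"
  shows "\<exists>c. facet_hamiltonian_cycle (B_permutahedron :: (real ^ 'n) set) c"
proof -
  let ?P = "B_permutahedron :: (real ^ 'n) set"
  obtain ys where ys: "3 \<le> length ys" "distinct ys" "\<And>w. w \<in> set ys \<Longrightarrow> signed_perm (UNIV :: 'n set) w"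
    "\<And>i. i < length ys \<Longrightarrow> word_adj (ys ! i) (ys ! (Suc i mod length ys))"
    "\<And>c. c \<in> signed_sets UNIV \<Longrightarrow> c \<noteq> {} \<Longrightarrow> \<exists>w\<in>set ys. c \<in> prefix_sets w"
    "\<And>c i j. i < length ys \<Longrightarrow> j < length ys \<Longrightarrow> c \<in> prefix_sets (ys ! i) \<Longrightarrow> c \<in> prefix_sets (ys ! j) \<Longrightarrow>
      (i, j) \<in> (cyclic_run (length ys) (\<lambda>k. c \<in> prefix_sets (ys ! k)))\<^sup>*"
    using cycle_exists[of "UNIV :: 'n set"] assms by auto
  define L where "L = length ys"
  define c where "c = map word_vec ys"
  have c_nth: "c ! i = word_vec (ys ! i)" if "i < L" for i
    using that unfolding c_def L_def by simp
  have L: "0 < L" "length c = L" using ys(1) unfolding L_def c_def by auto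
  have perm: "signed_perm UNIV (ys ! i)" if "i < L" for i using that ys(3) unfolding L_def by simp
  have edge: "{c ! i, c ! (Suc i mod L)} \<in> skeleton_edges ?P" if i: "i < L" for i
  proof -
    have j: "Suc i mod L < L" using L by simp
    have "closed_segment (c ! i) (c ! (Suc i mod L)) edge_of ?P"
      using word_adj_edge[OF perm[OF i]] ys(4)[of i] i c_nth[OF i] c_nth[OF j] unfolding L_def by simp
    then show ?thesis
      using word_vec_vertex[OF perm[OF i]] word_vec_vertex[OF perm[OF j]] c_nth[OF i] c_nth[OF j]
      unfolding skeleton_edges_def by auto
  qed
  have "is_cycle (skeleton_verts ?P) (skeleton_edges ?P) c"
    unfolding is_cycle_def
  proof (intro conjI)
    show "3 \<le> length c" using ys(1) unfolding c_def by simp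
    show "distinct c" using ys(2,3) word_vec_inj unfolding c_def by (auto simp: distinct_map inj_on_def)
    show "set c \<subseteq> skeleton_verts ?P" using ys(3) word_vec_vertex unfolding c_def by auto
    show "cycle_edges c \<subseteq> skeleton_edges ?P" using edge unfolding cycle_edges_def L(2) by blast
  qed
  moreover have "set c \<inter> F \<noteq> {} \<and> connected_graph (set c \<inter> F) {e \<in> cycle_edges c. e \<subseteq> F}"
    if F: "F facet_of ?P" for F
  proof -
    obtain d where d: "d \<in> signed_sets (UNIV :: 'n set)" "d \<noteq> {}"
      "\<And>w. signed_perm UNIV w \<Longrightarrow> word_vec w \<in> F \<longleftrightarrow> d \<in> prefix_sets w"
      using facet_prefix_set[OF F] by blast
    \<comment> \<open>Membership in \<open>F\<close> becomes a predicate on the positions of the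
      cycle, so connectedness inside \<open>F\<close> can be read off from
      \<open>cyclic_run\<close>.\<close>
    define P where "P = (\<lambda>k. d \<in> prefix_sets (ys ! k))"
    have P: "c ! k \<in> F \<longleftrightarrow> P k" if "k < L" for k
      unfolding P_def c_nth[OF that] by (rule d(3)[OF perm[OF that]])
    let ?R = "{(x, y). x \<in> set c \<inter> F \<and> y \<in> set c \<inter> F \<and> {x, y} \<in> {e \<in> cycle_edges c. e \<subseteq> F}}"
    \<comment> \<open>Neighbouring positions of the run are joined by a cycle edge with both ends in
      \<open>F\<close>; hence runs are carried to paths inside \<open>F\<close>.\<close>
    have run_edge: "(c ! i, c ! j) \<in> ?R" if "(i, j) \<in> cyclic_run L P" for i j
    proof -
      have ij: "i < L" "j < L" "P i" "P j" "j = Suc i mod L \<or> i = Suc j mod L"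
        using that unfolding cyclic_run_def by auto
      then have "{c ! i, c ! j} \<in> cycle_edges c"
        unfolding cycle_edges_def L(2) by (auto simp: insert_commute)
      then show ?thesis using ij P L(2) by auto
    qed
    have path: "(c ! i, c ! j) \<in> ?R\<^sup>*" if "(i, j) \<in> (cyclic_run L P)\<^sup>*" for i j
      using that
    proof (induction rule: rtrancl_induct)
      case (step k l)
      show ?case using step.IH run_edge[OF step.hyps(2)] by (rule rtrancl_into_rtrancl)
    qed simp
    have "connected_graph (set c \<inter> F) {e \<in> cycle_edges c. e \<subseteq> F}"
      unfolding connected_graph_def
    proof (intro ballI)
      fix u v assume uv: "u \<in> set c \<inter> F" "v \<in> set c \<inter> F"
      then obtain i j where ij: "i < L" "u = c ! i" "j < L" "v = c ! j"
        using L(2) by (metis IntD1 in_set_conv_nth)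
      then have "(i, j) \<in> (cyclic_run L P)\<^sup>*"
        using ys(6)[of i j d] uv P unfolding P_def L_def by auto
      then show "(u, v) \<in> ?R\<^sup>*" unfolding ij by (rule path)
    qed
    moreover have "set c \<inter> F \<noteq> {}"
      using ys(5)[OF d(1,2)] ys(3) d(3) unfolding c_def by fastforce
    ultimately show ?thesis by blast
  qed
  ultimately show ?thesis unfolding facet_hamiltonian_cycle_def by blast
qed

end
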